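(* $\mathbb{P}_o$-almost surely, $\ell(Z_n)/n$ converges as $n\to\infty$ to the constant $$\ell=\frac{\sum_{i\in\mathcal{I}}\bigl(1-(1-\xi_i)\,G_i(\xi_i)\bigr)\cdot G_i(\xi_i)\cdot(1-\xi_i)}{\sum_{i\in\mathcal{I}}\xi_i'(1)\cdot\bigl(G_i(\xi_i)-(1-\xi_i)\,G_i'(\xi_i)\bigr)}.$$
   Context: Let $\mathbb{N}=\{1,2,\dots\}$ and $\mathbb{N}_0=\mathbb{N}\cup\{0\}$. Let $\mathcal{I}=\{1,\dots,r\}$ with $r\ge 2$. For each $i\in\mathcal{I}$ let $V_i$ be a finite or countable set (the $V_i$ pairwise disjoint) with a chosen root $o_i\in V_i$ and a transition matrix $P_i=(p_i(x,y))_{x,y\in V_i}$ with $n$-step probabilities $p_i^{(n)}(x,y)$. Assume $p_i(x,x)=0$ for all $x\in V_i$, and that for every $x\in V_i$ there is $n\in\mathbb{N}$ with $p_i^{(n)}(o_i,x)>0$. Put $V_i^\times=V_i\setminus\{o_i\}$. The free product $V=V_1\ast\dots\ast V_r$ is the set of finite words $x_1\dots x_m$ with letters (blocks) in $\bigcup_i V_i^\times$ such that no two consecutive letters come from the same $V_i$, including the empty word $o$. Each $V_i$ is regarded as a subset of $V$ by identifying $o_i$ with $o$. The block length of $x=x_1\dots x_m\ne o$ is $\ell(x)=m$, and $\ell(o)=0$. Fix $\alpha_1,\dots,\alpha_r>0$ with $\sum_i\alpha_i=1$. Let $\bar P_i$ be the lift of $P_i$ to $V$: $\bar p_i(zv,zw)=p_i(v,w)$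 if $v,w\in V_i$ and $z\in V$ is $o$ or has last letter not in $V_i$; $\bar p_i(x,y)=0$ otherwise. The random walk $(Z_n)_{n\in\mathbb{N}_0}$ on $V$ has transition matrix $P=\sum_i\alpha_i\bar P_i$, with $n$-step probabilities $p^{(n)}(x,y)$, and $\mathbb{P}_x$ denotes its law started at $x$. Standing assumption: the power series $G(o,o|z)=\sum_{n\ge0}p^{(n)}(o,o)z^n$ has radius of convergence greater than $1$. Let $S_o=\min\{k>0: Z_k=o\}$, $\bar H_i(z)=\sum_{n\ge2}\mathbb{P}_o[S_o=n, Z_1\notin V_i]z^n$, $\xi_i(z)=\dfrac{\alpha_i z}{1-\bar H_i(z)}$, and $\xi_i=\xi_i(1)$ (one has $\xi_i<1$); $\xi_i'(1)$ is the derivative of $\xi_i(z)$ at $z=1$. Put $G_i(z)=G_i(o_i,o_i|z)=\sum_{n\ge0}p_i^{(n)}(o_i,o_i)z^n$, with derivative $G_i'(z)$. *)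

theory Defs
  imports "HOL-Probability.Probability"
begin

definition transition_matrix :: "'s set \<Rightarrow> ('s \<Rightarrow> 's \<Rightarrow> real) \<Rightarrow> bool" where
  "transition_matrix S p \<longleftrightarrow>
     (\<forall>x\<in>S. (\<forall>y\<in>S. 0 \<le> p x y) \<and> ((\<lambda>y. p x y) has_sum 1) S)"

fun nstep :: "'s set \<Rightarrow> ('s \<Rightarrow> 's \<Rightarrow> real) \<Rightarrow> nat \<Rightarrow> 's \<Rightarrow> 's \<Rightarrow> real" where
  "nstep S p 0 x y = (if x = y then 1 else 0)"
| "nstep S p (Suc n) x y = (\<Sum>\<^sub>\<infinity>w\<in>S. p x w * nstep S p n w y)"

definition green :: "'s set \<Rightarrow> ('s \<Rightarrow> 's \<Rightarrow> real) \<Rightarrow> 's \<Rightarrow> 's \<Rightarrow> real \<Rightarrow> real" where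
  "green S p x y z = (\<Sum>n. nstep S p n x y * z ^ n)"

text \<open>The process \<open>Z\<close> on the probability space \<open>M\<close> is a Markov chain on the countable state
  space \<open>S\<close> with transition matrix \<open>p\<close> started at \<open>x\<close>; its law is given by the
  finite-dimensional distributions.\<close>

definition markov_chain_from ::
    "'w measure \<Rightarrow> 's set \<Rightarrow> ('s \<Rightarrow> 's \<Rightarrow> real) \<Rightarrow> 's \<Rightarrow> (nat \<Rightarrow> 'w \<Rightarrow> 's) \<Rightarrow> bool" where
  "markov_chain_from M S p x Z \<longleftrightarrow>
     prob_space M \<and>
     (\<forall>n. Z n \<in> measurable M (count_space S)) \<and>
     (\<forall>n y. (\<forall>k\<le>n. y k \<in> S) \<longrightarrow>
        measure M {\<omega> \<in> space M. \<forall>k\<le>n. Z k \<omega> = y k} =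
          (if y 0 = x then 1 else 0) * (\<Prod>k<n. p (y k) (y (Suc k))))"

text \<open>The infimum of the empty set in \<^typ>\<open>enat\<close> is \<open>\<infinity>\<close>.\<close>

definition return_time :: "(nat \<Rightarrow> 'w \<Rightarrow> 's) \<Rightarrow> 's \<Rightarrow> 'w \<Rightarrow> enat" where
  "return_time Z x \<omega> = Inf (enat ` {k. 0 < k \<and> Z k \<omega> = x})"

text \<open>The free product of \<open>V 1, \<dots>, V r\<close> with roots \<open>rt i\<close> consists of words, coded as lists of
  blocks; the empty word \<open>o\<close> is \<open>[]\<close> and the block length is \<^const>\<open>length\<close>.\<close>

definition free_product :: "nat \<Rightarrow> (nat \<Rightarrow> 'a set) \<Rightarrow> (nat \<Rightarrow> 'a) \<Rightarrow> 'a list set" where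
  "free_product r V rt =
     {x. set x \<subseteq> (\<Union>i\<in>{1..r}. V i - {rt i}) \<and>
         successively (\<lambda>a b. \<forall>i\<in>{1..r}. \<not> (a \<in> V i \<and> b \<in> V i)) x}"

text \<open>\<open>app (rt i) z v\<close> is the word \<open>zv\<close> for \<open>v \<in> V i\<close>, where the root of \<open>V i\<close> is identified with
  the empty word.\<close>

definition app :: "'a \<Rightarrow> 'a list \<Rightarrow> 'a \<Rightarrow> 'a list" where
  "app e z v = (if v = e then z else z @ [v])"

definition factor_in_product :: "(nat \<Rightarrow> 'a set) \<Rightarrow> (nat \<Rightarrow> 'a) \<Rightarrow> nat \<Rightarrow> 'a list set" where
  "factor_in_product V rt i = app (rt i) [] ` V i"

definition lift_pair :: "nat \<Rightarrow> (nat \<Rightarrow> 'a set) \<Rightarrow> (nat \<Rightarrow> 'a) \<Rightarrow> nat \<Rightarrow>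
    'a list \<Rightarrow> 'a list \<Rightarrow> 'a \<Rightarrow> 'a \<Rightarrow> bool" where
  "lift_pair r V rt i x y v w \<longleftrightarrow>
     v \<in> V i \<and> w \<in> V i \<and>
     (\<exists>z \<in> free_product r V rt. (z = [] \<or> last z \<notin> V i) \<and>
        x = app (rt i) z v \<and> y = app (rt i) z w)"

definition lifted :: "nat \<Rightarrow> (nat \<Rightarrow> 'a set) \<Rightarrow> (nat \<Rightarrow> 'a) \<Rightarrow> (nat \<Rightarrow> 'a \<Rightarrow> 'a \<Rightarrow> real) \<Rightarrow> nat \<Rightarrow>
    'a list \<Rightarrow> 'a list \<Rightarrow> real" where
  "lifted r V rt p i x y =
     (if \<exists>v w. lift_pair r V rt i x y v w
      then THE q. \<exists>v w. lift_pair r V rt i x y v w \<and> q = p i v w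
      else 0)"

text \<open>The pair \<open>(v, w)\<close> is determined by the two words, so the description above is proper.\<close>

lemma lift_pair_unique:
  assumes "lift_pair r V rt i x y v w" "lift_pair r V rt i x y v' w'"
  shows "v = v' \<and> w = w'"
  using assms unfolding lift_pair_def app_def
  by (auto split: if_splits)

lemma lifted_app:
  assumes "v \<in> V i" "w \<in> V i" "z \<in> free_product r V rt" "z = [] \<or> last z \<notin> V i"
  shows "lifted r V rt p i (app (rt i) z v) (app (rt i) z w) = p i v w"
proof -
  have *: "lift_pair r V rt i (app (rt i) z v) (app (rt i) z w) v w"
    using assms unfolding lift_pair_def by blast
  have "(THE q. \<exists>v' w'. lift_pair r V rt i (app (rt i) z v) (app (rt i) z w) v' w' \<and> q = p i v' w')
      = p i v w" (is "The ?Q = _")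
  proof (rule the_equality)
    show "?Q (p i v w)" using * by metis
  next
    fix q assume "?Q q"
    then obtain v' w' where "lift_pair r V rt i (app (rt i) z v) (app (rt i) z w) v' w'"
      and q: "q = p i v' w'" by metis
    from lift_pair_unique[OF * this(1)] q show "q = p i v w" by simp
  qed
  with * show ?thesis unfolding lifted_def by metis
qed

definition walk_matrix :: "nat \<Rightarrow> (nat \<Rightarrow> 'a set) \<Rightarrow> (nat \<Rightarrow> 'a) \<Rightarrow> (nat \<Rightarrow> 'a \<Rightarrow> 'a \<Rightarrow> real) \<Rightarrow>
    (nat \<Rightarrow> real) \<Rightarrow> 'a list \<Rightarrow> 'a list \<Rightarrow> real" where
  "walk_matrix r V rt p \<alpha> x y = (\<Sum>i\<in>{1..r}. \<alpha> i * lifted r V rt p i x y)"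

definition Hbar :: "'w measure \<Rightarrow> (nat \<Rightarrow> 'w \<Rightarrow> 'a list) \<Rightarrow> (nat \<Rightarrow> 'a set) \<Rightarrow> (nat \<Rightarrow> 'a) \<Rightarrow>
    nat \<Rightarrow> real \<Rightarrow> real" where
  "Hbar M Z V rt i z =
     (\<Sum>n. if 2 \<le> n
           then measure M {\<omega> \<in> space M. return_time Z [] \<omega> = enat n \<and>
                                        Z 1 \<omega> \<notin> factor_in_product V rt i} * z ^ n
           else 0)"

definition xi :: "'w measure \<Rightarrow> (nat \<Rightarrow> 'w \<Rightarrow> 'a list) \<Rightarrow> (nat \<Rightarrow> 'a set) \<Rightarrow> (nat \<Rightarrow> 'a) \<Rightarrow>
    (nat \<Rightarrow> real) \<Rightarrow> nat \<Rightarrow> real \<Rightarrow> real" where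
  "xi M Z V rt \<alpha> i z = \<alpha> i * z / (1 - Hbar M Z V rt i z)"

end

theory Submission
  imports Defs
begin

text \<open>
  The proof estimates the distribution of the block length of \<open>Z n\<close> through Green functions, for
  \<open>z\<close> on both sides of \<open>1\<close>, and does not follow the trajectories to the boundary.

  Let \<open>H i\<close> be the generating function of the returns to the empty word that start in a factor other
  than \<open>V i\<close>. Watched on one copy of \<open>V i\<close>, the walk is the chain \<open>p i\<close>, interrupted at every
  vertex by excursions into the other copies attached there, so that each step on the copy carries the
  weight \<open>\<xi> i = \<alpha> i z / (1 - H i)\<close>. Generating functions therefore factorise along words. If
  \<open>L i s v\<close> is the quotient of the Green functions of \<open>p i\<close> from the root to \<open>v\<close> and to the root, then
  the Green function of the walk from the empty word to \<open>x\<^sub>1 \<dots> x\<^sub>m\<close> is at most its value at the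
  empty word times the product of the \<open>L i (\<xi> i) x\<^sub>k\<close>, where \<open>i\<close> is the factor of \<open>x\<^sub>k\<close>
  (\<open>kgreen_le_wprod\<close>). These facts are obtained without decomposing paths: Green functions and first
  passage functions are least solutions of one-step equations, and are compared with explicit
  supersolutions. The lower bound for first passages (\<open>hit_cone\<close>, \<open>factor_hit_le\<close>) is what shows
  that the products are supersolutions (\<open>wprod_supersolution\<close>).

  Over \<open>v \<noteq> rt i\<close> the weights \<open>L i s v\<close> sum up to \<open>A i s = 1 / ((1 - s) Gr i s) - 1\<close>, where
  \<open>Gr i\<close> is the Green function of \<open>p i\<close> at the root (\<open>L_sum\<close>). So the words of length \<open>m\<close>
  have as their total weight the sum of the products of \<open>A\<close> over index sequences of length \<open>m\<close>
  without repeated neighbours. The transfer matrix of this sum has the eigenvalue \<open>\<rho>\<close> if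
  \<open>(\<Sum>i. A i / (\<rho> + A i)) = 1\<close>, and \<open>\<le> 1\<close> suffices for a bound by a constant times \<open>\<rho> ^ m\<close>
  (\<open>weight_words_from_le\<close>). Hence \<open>\<theta> ^ length (Z n \<omega>)\<close> has a mean of at most the order
  \<open>z powr (- n)\<close> if \<open>\<theta> \<rho> < 1\<close> (\<open>exponential_moment\<close>).

  For \<open>z = 1\<close> the eigenvalue is \<open>\<rho> = 1\<close> (\<open>A_sum\<close>), which uses that \<open>\<xi> i < 1\<close>, a consequence of
  transience (\<open>\<xi>_less_1\<close>). Differentiating the eigenvalue equation at \<open>1\<close> gives the slope of \<open>\<rho>\<close> as
  denominator over numerator of the claimed rate (\<open>eigenvalue_deriv\<close>). By the exponential Markov
  inequality, with \<open>z\<close> slightly smaller or slightly larger than \<open>1\<close>, the probability that the block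
  length exceeds \<open>c n\<close>, or falls below \<open>c n\<close>, decays exponentially for each \<open>c\<close> above, or
  below, the rate (\<open>deviation\<close>), and the Borel-Cantelli lemma gives almost sure convergence.
\<close>

section \<open>Green functions and first passage of nonnegative kernels\<close>

text \<open>The variable \<open>z\<close> of a generating function is absorbed into the kernel: for \<open>q = z p\<close> the powers below
carry the factor \<open>z ^ n\<close>, \<open>kgreen\<close> is the Green function at \<open>z\<close>, and \<open>hit\<close> is the generating function
of the first passage to \<open>e\<close>. With values in \<open>ennreal\<close> all the series converge, and finiteness is only
required where something is cancelled.\<close>

primrec kpow :: "'s set \<Rightarrow> ('s \<Rightarrow> 's \<Rightarrow> ennreal) \<Rightarrow> nat \<Rightarrow> 's \<Rightarrow> 's \<Rightarrow> ennreal" where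
  "kpow S q 0 x y = (if x = y then 1 else 0)"
| "kpow S q (Suc n) x y = (\<integral>\<^sup>+w. q x w * kpow S q n w y \<partial>count_space S)"

definition kgreen :: "'s set \<Rightarrow> ('s \<Rightarrow> 's \<Rightarrow> ennreal) \<Rightarrow> 's \<Rightarrow> 's \<Rightarrow> ennreal" where
  "kgreen S q x y = (\<Sum>n. kpow S q n x y)"

primrec fpass :: "'s set \<Rightarrow> ('s \<Rightarrow> 's \<Rightarrow> ennreal) \<Rightarrow> 's \<Rightarrow> nat \<Rightarrow> 's \<Rightarrow> ennreal" where
  "fpass S q e 0 x = (if x = e then 1 else 0)"
| "fpass S q e (Suc n) x = (if x = e then 0 else \<integral>\<^sup>+w. q x w * fpass S q e n w \<partial>count_space S)"

definition hit :: "'s set \<Rightarrow> ('s \<Rightarrow> 's \<Rightarrow> ennreal) \<Rightarrow> 's \<Rightarrow> 's \<Rightarrow> ennreal" where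
  "hit S q e x = (\<Sum>n. fpass S q e n x)"

lemma nn_integral_count_space_delta:
  "y \<in> S \<Longrightarrow> (\<integral>\<^sup>+w. f w * (if w = y then 1 else 0) \<partial>count_space S) = f y"
  "y \<in> S \<Longrightarrow> (\<integral>\<^sup>+w. (if y = w then 1 else 0) * f w \<partial>count_space S) = f y"
  for f :: "'s \<Rightarrow> ennreal"
  by (subst nn_integral_count_space'[where A = "{y}"]; simp)+

lemma kpow_Suc_right:
  assumes "countable S" "x \<in> S" "y \<in> S"
  shows "kpow S q (Suc n) x y = (\<integral>\<^sup>+w. kpow S q n x w * q w y \<partial>count_space S)"
  using assms(2)
proof (induction n arbitrary: x)
  case 0
  then show ?case using assms(3) by (simp add: nn_integral_count_space_delta)
next
  case (Suc n)
  have "kpow S q (Suc (Suc n)) x y =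
      (\<integral>\<^sup>+w. \<integral>\<^sup>+v. q x w * kpow S q n w v * q v y \<partial>count_space S \<partial>count_space S)"
    unfolding kpow.simps(2)[of S q "Suc n"]
    by (intro nn_integral_cong)
      (simp add: Suc.IH nn_integral_cmult[symmetric] mult.assoc del: kpow.simps(2))
  also have "\<dots> = (\<integral>\<^sup>+v. \<integral>\<^sup>+w. q x w * kpow S q n w v * q v y \<partial>count_space S \<partial>count_space S)"
    by (rule nn_integral_count_space_nn_integral) (use assms in auto)
  also have "\<dots> = (\<integral>\<^sup>+v. kpow S q (Suc n) x v * q v y \<partial>count_space S)"
    by (simp add: nn_integral_multc)
  finally show ?case .
qed

lemma suminf_split_first: "(\<Sum>n. f n) = f 0 + (\<Sum>n. f (Suc n))" for f :: "nat \<Rightarrow> ennreal"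
  using suminf_offset[OF summableI, of f 1] by simp

lemma kgreen_left: "kgreen S q x y = (if x = y then 1 else 0) + (\<integral>\<^sup>+w. q x w * kgreen S q w y \<partial>count_space S)"
  unfolding kgreen_def
  by (subst suminf_split_first) (simp add: nn_integral_suminf ennreal_suminf_cmult[symmetric] del: ennreal_suminf_cmult)

lemma kgreen_right:
  assumes "countable S" "x \<in> S" "y \<in> S"
  shows "kgreen S q x y = (if x = y then 1 else 0) + (\<integral>\<^sup>+w. kgreen S q x w * q w y \<partial>count_space S)"
  unfolding kgreen_def
  by (subst suminf_split_first)
    (simp add: kpow_Suc_right[OF assms] nn_integral_suminf ennreal_suminf_multc[symmetric]
      del: kpow.simps(2) ennreal_suminf_multc)

lemma hit_start [simp]: "hit S q e e = 1"
  unfolding hit_def by (subst suminf_split_first) simp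

lemma hit_step: "x \<noteq> e \<Longrightarrow> hit S q e x = (\<integral>\<^sup>+w. q x w * hit S q e w \<partial>count_space S)"
  unfolding hit_def
  by (subst suminf_split_first) (simp add: nn_integral_suminf ennreal_suminf_cmult[symmetric] del: ennreal_suminf_cmult)

lemma suminf_le_bound: "(\<And>N. (\<Sum>n<N. f n) \<le> c) \<Longrightarrow> (\<Sum>n. f n) \<le> c" for f :: "nat \<Rightarrow> ennreal"
  by (rule suminf_le_const[OF summableI])

lemma sum_fpass_Suc:
  "x \<noteq> e \<Longrightarrow> (\<Sum>n<Suc N. fpass S q e n x) = (\<integral>\<^sup>+w. q x w * (\<Sum>n<N. fpass S q e n w) \<partial>count_space S)"
  by (subst sum.lessThan_Suc_shift) (simp add: nn_integral_sum[symmetric] sum_distrib_left)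

lemma sum_fpass_start: "(\<Sum>n<N. fpass S q e n e) \<le> 1"
  by (cases N) (simp_all del: sum.lessThan_Suc add: sum.lessThan_Suc_shift)

lemma kpow_partial_sum_Suc:
  "(\<Sum>n<Suc N. kpow S q n x y) =
     (if x = y then 1 else 0) + (\<integral>\<^sup>+w. q x w * (\<Sum>n<N. kpow S q n w y) \<partial>count_space S)"
  by (subst sum.lessThan_Suc_shift) (simp add: nn_integral_sum[symmetric] sum_distrib_left)

lemma kpow_partial_sum_Suc_right:
  assumes "countable S" "x \<in> S" "y \<in> S"
  shows "(\<Sum>n<Suc N. kpow S q n x y) =
     (if x = y then 1 else 0) + (\<integral>\<^sup>+w. (\<Sum>n<N. kpow S q n x w) * q w y \<partial>count_space S)"
  by (subst sum.lessThan_Suc_shift)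
    (simp add: kpow_Suc_right[OF assms] nn_integral_sum[symmetric] sum_distrib_right del: kpow.simps(2))

text \<open>The first passage generating function is the least solution of its one-step equation, because the
paths of bounded length are dominated by any supersolution \<open>h\<close>, by induction on the bound.\<close>

lemma hit_minimal:
  assumes h1: "h e \<ge> 1" and h2: "\<And>x. x \<in> S \<Longrightarrow> x \<noteq> e \<Longrightarrow> (\<integral>\<^sup>+w. q x w * h w \<partial>count_space S) \<le> h x"
    and x: "x \<in> S"
  shows "hit S q e x \<le> h x"
  unfolding hit_def
proof (rule suminf_le_bound)
  show "(\<Sum>n<N. fpass S q e n x) \<le> h x" for N
    using x
  proof (induction N arbitrary: x)
    case (Suc N)
    show ?case
    proof (cases "x = e")
      case True
      show ?thesis unfolding True by (rule order_trans[OF sum_fpass_start h1])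
    next
      case False
      have "(\<Sum>n<Suc N. fpass S q e n x) \<le> (\<integral>\<^sup>+w. q x w * h w \<partial>count_space S)"
        unfolding sum_fpass_Suc[OF False]
        by (intro nn_integral_mono mult_left_mono Suc.IH) auto
      then show ?thesis using h2[OF Suc.prems False] by (rule order_trans)
    qed
  qed simp
qed

lemma kgreen_le_supersolution_left:
  assumes h1: "h e \<ge> 1" and h2: "\<And>x. x \<in> S \<Longrightarrow> x \<noteq> e \<Longrightarrow> (\<integral>\<^sup>+w. q x w * h w \<partial>count_space S) \<le> h x"
    and x: "x \<in> S"
  shows "kgreen S q x e \<le> h x * kgreen S q e e"
  unfolding kgreen_def[of S q x]
proof (rule suminf_le_bound)
  show "(\<Sum>n<N. kpow S q n x e) \<le> h x * kgreen S q e e" for N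
    using x
  proof (induction N arbitrary: x)
    case (Suc N)
    show ?case
    proof (cases "x = e")
      case True
      have "(\<Sum>n<Suc N. kpow S q n x e) \<le> kgreen S q e e"
        unfolding kgreen_def True by (rule sum_le_suminf) auto
      also have "\<dots> \<le> h e * kgreen S q e e" using mult_right_mono[OF h1, of "kgreen S q e e"] by simp
      finally show ?thesis using True by simp
    next
      case False
      have "(\<Sum>n<Suc N. kpow S q n x e) \<le> (\<integral>\<^sup>+w. q x w * (h w * kgreen S q e e) \<partial>count_space S)"
        unfolding kpow_partial_sum_Suc using False
        by (auto intro!: nn_integral_mono mult_left_mono Suc.IH)
      also have "\<dots> = (\<integral>\<^sup>+w. q x w * h w \<partial>count_space S) * kgreen S q e e"
        by (subst nn_integral_multc[symmetric]) (auto simp: mult.assoc)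
      also have "\<dots> \<le> h x * kgreen S q e e" by (intro mult_right_mono h2 Suc.prems False) auto
      finally show ?thesis .
    qed
  qed simp
qed

text \<open>The first passage decomposition. Both inequalities come from minimality: \<open>hit\<close> is a supersolution for
the Green function, and the normalised Green function is one for \<open>hit\<close>.\<close>

lemma kgreen_eq_hit:
  assumes x: "x \<in> S" and e: "e \<in> S" and fin: "kgreen S q e e < \<infinity>"
  shows "kgreen S q x e = hit S q e x * kgreen S q e e"
proof (rule antisym)
  show "kgreen S q x e \<le> hit S q e x * kgreen S q e e"
    by (rule kgreen_le_supersolution_left) (auto simp: hit_step x)
  have ge1: "kgreen S q e e \<ge> 1" by (subst kgreen_left) simp
  \<comment> \<open>The divisor is finite and at least \<open>1\<close>, so that it cancels in \<open>ennreal\<close>.\<close>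
  have "hit S q e x \<le> kgreen S q x e / kgreen S q e e"
  proof (rule hit_minimal[OF _ _ x])
    show "1 \<le> kgreen S q e e / kgreen S q e e" using ge1 fin by (subst ennreal_divide_self) auto
    fix y assume "y \<in> S" "y \<noteq> e"
    then show "(\<integral>\<^sup>+w. q y w * (kgreen S q w e / kgreen S q e e) \<partial>count_space S) \<le> kgreen S q y e / kgreen S q e e"
      by (subst (3) kgreen_left) (simp add: ennreal_times_divide nn_integral_divide)
  qed
  then have "hit S q e x * kgreen S q e e \<le> kgreen S q x e / kgreen S q e e * kgreen S q e e"
    by (intro mult_right_mono) auto
  also have "\<dots> = kgreen S q x e"
    using ge1 fin by (subst ennreal_divide_times, subst ennreal_divide_self) auto
  finally show "hit S q e x * kgreen S q e e \<le> kgreen S q x e" .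
qed

lemma kgreen_return_hit:
  assumes e: "e \<in> S" and fin: "kgreen S q e e < \<infinity>"
  shows "kgreen S q e e = 1 + (\<integral>\<^sup>+w. q e w * hit S q e w \<partial>count_space S) * kgreen S q e e"
proof -
  have "kgreen S q e e = 1 + (\<integral>\<^sup>+w. q e w * kgreen S q w e \<partial>count_space S)"
    by (subst kgreen_left) simp
  also have "(\<integral>\<^sup>+w. q e w * kgreen S q w e \<partial>count_space S) =
      (\<integral>\<^sup>+w. q e w * hit S q e w * kgreen S q e e \<partial>count_space S)"
    by (intro nn_integral_cong) (simp add: kgreen_eq_hit[OF _ e fin] mult.assoc)
  also have "\<dots> = (\<integral>\<^sup>+w. q e w * hit S q e w \<partial>count_space S) * kgreen S q e e"
    by (rule nn_integral_multc) simp
  finally show ?thesis .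
qed

text \<open>The same comparison in the second variable, where \<open>h\<close> plays the part of the weight of all paths
from \<open>e\<close> after their last visit to \<open>e\<close>.\<close>

lemma kgreen_le_supersolution_right:
  assumes S: "countable S" and e: "e \<in> S" and h1: "h e \<ge> 1"
    and h2: "\<And>y. y \<in> S \<Longrightarrow> y \<noteq> e \<Longrightarrow> (\<integral>\<^sup>+w. h w * q w y \<partial>count_space S) \<le> h y"
    and y: "y \<in> S"
  shows "kgreen S q e y \<le> kgreen S q e e * h y"
  unfolding kgreen_def[of S q e y]
proof (rule suminf_le_bound)
  show "(\<Sum>n<N. kpow S q n e y) \<le> kgreen S q e e * h y" for N
    using y
  proof (induction N arbitrary: y)
    case (Suc N)
    show ?case
    proof (cases "y = e")
      case True
      have "(\<Sum>n<Suc N. kpow S q n e y) \<le> kgreen S q e e"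
        unfolding kgreen_def True by (rule sum_le_suminf) auto
      also have "\<dots> \<le> kgreen S q e e * h e" using mult_left_mono[OF h1, of "kgreen S q e e"] by simp
      finally show ?thesis using True by simp
    next
      case False
      have "(\<Sum>n<Suc N. kpow S q n e y) \<le> (\<integral>\<^sup>+w. kgreen S q e e * h w * q w y \<partial>count_space S)"
        unfolding kpow_partial_sum_Suc_right[OF S e Suc.prems] using False
        by (auto intro!: nn_integral_mono mult_right_mono Suc.IH)
      also have "\<dots> = kgreen S q e e * (\<integral>\<^sup>+w. h w * q w y \<partial>count_space S)"
        by (subst nn_integral_cmult[symmetric]) (auto simp: mult.assoc)
      also have "\<dots> \<le> kgreen S q e e * h y" by (intro mult_left_mono h2 Suc.prems False) auto
      finally show ?thesis .
    qed
  qed simp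
qed

section \<open>Markov chains and their generating functions\<close>

lemma nn_integral_eq_infsum:
  fixes f :: "'s \<Rightarrow> real"
  assumes "f summable_on S" "\<And>x. x \<in> S \<Longrightarrow> 0 \<le> f x"
  shows "(\<integral>\<^sup>+x. ennreal (f x) \<partial>count_space S) = ennreal (infsum f S)"
proof -
  have "(\<lambda>x. norm (f x)) summable_on S"
    using assms by (subst summable_on_cong[where g = f]) auto
  then have "Infinite_Set_Sum.abs_summable_on f S" by (rule abs_summable_equivalent[THEN iffD1])
  then show ?thesis
    using nn_integral_conv_infsetsum[of f S] assms(2) by (simp add: infsetsum_infsum)
qed

lemma transition_matrix_sum:
  assumes "transition_matrix S p" "x \<in> S"
  shows "(\<integral>\<^sup>+y. ennreal (p x y) \<partial>count_space S) = 1"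
  using assms nn_integral_eq_infsum[of "p x" S] unfolding transition_matrix_def
  by (auto simp: has_sum_imp_summable infsumI)

lemma nstep_bounds_and_kpow:
  assumes tm: "transition_matrix S p" and x: "x \<in> S"
  shows "0 \<le> nstep S p n x y \<and> nstep S p n x y \<le> 1 \<and>
    ennreal (nstep S p n x y) = kpow S (\<lambda>x y. ennreal (p x y)) n x y"
  using x
proof (induction n arbitrary: x)
  case (Suc n)
  have sm: "p x summable_on S" and inf1: "infsum (p x) S = 1" and nn: "\<And>w. w \<in> S \<Longrightarrow> 0 \<le> p x w"
    using tm Suc.prems unfolding transition_matrix_def by (auto simp: has_sum_imp_summable infsumI)
  have le: "p x w * nstep S p n w y \<le> p x w" if "w \<in> S" for w
    using Suc.IH[OF that] nn[OF that] by (simp add: mult_left_le)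
  have sm2: "(\<lambda>w. p x w * nstep S p n w y) summable_on S"
    by (rule summable_on_comparison_test[OF sm le]) (use Suc.IH nn in auto)
  have "infsum (\<lambda>w. p x w * nstep S p n w y) S \<le> 1"
    using infsum_mono[OF sm2 sm le] inf1 by simp
  moreover have "0 \<le> infsum (\<lambda>w. p x w * nstep S p n w y) S"
    by (rule infsum_nonneg) (use Suc.IH nn in auto)
  moreover have "ennreal (infsum (\<lambda>w. p x w * nstep S p n w y) S) =
      (\<integral>\<^sup>+w. ennreal (p x w) * kpow S (\<lambda>x y. ennreal (p x y)) n w y \<partial>count_space S)"
    by (subst nn_integral_eq_infsum[OF sm2, symmetric])
      (use Suc.IH nn in \<open>auto intro!: nn_integral_cong simp: ennreal_mult'\<close>)
  ultimately show ?case by simp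
qed simp

lemma kpow_scale:
  assumes z: "0 \<le> z"
  shows "kpow S (\<lambda>x y. ennreal (z * p x y)) n x y = ennreal (z ^ n) * kpow S (\<lambda>x y. ennreal (p x y)) n x y"
proof (induction n arbitrary: x)
  case (Suc n)
  have "kpow S (\<lambda>x y. ennreal (z * p x y)) (Suc n) x y =
      (\<integral>\<^sup>+w. ennreal (z ^ Suc n) * (ennreal (p x w) * kpow S (\<lambda>x y. ennreal (p x y)) n w y) \<partial>count_space S)"
    unfolding kpow.simps Suc.IH using z by (auto intro!: nn_integral_cong simp: ennreal_mult' mult_ac)
  then show ?case by (simp add: nn_integral_cmult del: power_Suc)
qed simp

lemma fpass_scale:
  assumes z: "0 \<le> z"
  shows "fpass S (\<lambda>x y. ennreal (z * p x y)) e n x = ennreal (z ^ n) * fpass S (\<lambda>x y. ennreal (p x y)) e n x"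
proof (induction n arbitrary: x)
  case (Suc n)
  have "(\<integral>\<^sup>+w. ennreal (z * p x w) * fpass S (\<lambda>x y. ennreal (z * p x y)) e n w \<partial>count_space S) =
      (\<integral>\<^sup>+w. ennreal (z ^ Suc n) * (ennreal (p x w) * fpass S (\<lambda>x y. ennreal (p x y)) e n w) \<partial>count_space S)"
    unfolding Suc.IH using z by (auto intro!: nn_integral_cong simp: ennreal_mult' mult_ac)
  then show ?case by (simp add: nn_integral_cmult del: power_Suc)
qed simp

lemma nstep_power_eq_kpow:
  assumes "transition_matrix S p" "x \<in> S" "0 \<le> z"
  shows "ennreal (nstep S p n x y * z ^ n) = kpow S (\<lambda>x y. ennreal (z * p x y)) n x y"
  unfolding kpow_scale[OF assms(3)]
  using nstep_bounds_and_kpow[OF assms(1,2), of n y] assms(3)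
  by (simp add: ennreal_mult' mult.commute)

lemma kgreen_eq_green:
  assumes "transition_matrix S p" "x \<in> S" "0 \<le> z"
    and sm: "summable (\<lambda>n. nstep S p n x y * z ^ n)"
  shows "kgreen S (\<lambda>x y. ennreal (z * p x y)) x y = ennreal (green S p x y z)"
proof -
  have nn: "0 \<le> nstep S p n x y" for n using nstep_bounds_and_kpow[OF assms(1,2)] by auto
  show ?thesis unfolding kgreen_def green_def
    using assms nn by (simp add: nstep_power_eq_kpow[symmetric] suminf_ennreal2)
qed

lemma kpow_row_sum:
  assumes tm: "transition_matrix S p" and S: "countable S" and x: "x \<in> S" and z: "0 \<le> z"
  shows "(\<integral>\<^sup>+y. kpow S (\<lambda>x y. ennreal (z * p x y)) n x y \<partial>count_space S) = ennreal (z ^ n)"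
  using x
proof (induction n arbitrary: x)
  case 0
  have "(\<integral>\<^sup>+y. (if x = y then 1 else 0) * (1::ennreal) \<partial>count_space S) = 1"
    by (rule nn_integral_count_space_delta(2)) (rule 0)
  then show ?case by simp
next
  case (Suc n)
  let ?q = "\<lambda>x y. ennreal (z * p x y)"
  have "(\<integral>\<^sup>+y. kpow S ?q (Suc n) x y \<partial>count_space S) =
      (\<integral>\<^sup>+w. \<integral>\<^sup>+y. ?q x w * kpow S ?q n w y \<partial>count_space S \<partial>count_space S)"
    unfolding kpow.simps by (rule nn_integral_count_space_nn_integral) (use S in auto)
  also have "\<dots> = (\<integral>\<^sup>+w. ennreal (z ^ Suc n) * ennreal (p x w) \<partial>count_space S)"
  proof (intro nn_integral_cong)
    fix w assume "w \<in> space (count_space S)"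
    then have "(\<integral>\<^sup>+y. ?q x w * kpow S ?q n w y \<partial>count_space S) = ?q x w * ennreal (z ^ n)"
      by (subst nn_integral_cmult) (auto simp: Suc.IH)
    also have "\<dots> = ennreal (z ^ Suc n) * ennreal (p x w)"
      using z by (simp add: ennreal_mult' ennreal_mult'' mult_ac)
    finally show "(\<integral>\<^sup>+y. ?q x w * kpow S ?q n w y \<partial>count_space S) = ennreal (z ^ Suc n) * ennreal (p x w)" .
  qed
  also have "\<dots> = ennreal (z ^ Suc n)"
    using transition_matrix_sum[OF tm Suc.prems] by (simp add: nn_integral_cmult)
  finally show ?case .
qed

lemma kgreen_row_sum:
  assumes tm: "transition_matrix S p" and S: "countable S" and x: "x \<in> S" and z: "0 \<le> z" "z < 1"
  shows "(\<integral>\<^sup>+y. kgreen S (\<lambda>x y. ennreal (z * p x y)) x y \<partial>count_space S) = ennreal (1 / (1 - z))"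
  unfolding kgreen_def
  using z kpow_row_sum[OF tm S x z(1)]
  by (subst nn_integral_suminf) (auto simp: suminf_ennreal2 summable_geometric suminf_geometric)

text \<open>Prescribing a set for each of the next positions is general enough to describe the marginals as well
as the event that the first return happens at a given time.\<close>

primrec visit_prob :: "('s \<Rightarrow> 's \<Rightarrow> real) \<Rightarrow> 's set list \<Rightarrow> 's \<Rightarrow> ennreal" where
  "visit_prob p [] x = 1"
| "visit_prob p (B # Bs) x = (\<integral>\<^sup>+y. ennreal (p x y) * visit_prob p Bs y \<partial>count_space B)"

lemma markov_chain_visits:
  assumes mc: "markov_chain_from M S p x0 Z" and S: "countable S"
    and nn: "\<And>x y. x \<in> S \<Longrightarrow> y \<in> S \<Longrightarrow> 0 \<le> p x y"
  shows "(\<forall>k\<le>m. y k \<in> S) \<Longrightarrow> (\<forall>B\<in>set Bs. B \<subseteq> S) \<Longrightarrow>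
    emeasure M {\<omega> \<in> space M. (\<forall>k\<le>m. Z k \<omega> = y k) \<and> (\<forall>j<length Bs. Z (Suc (m + j)) \<omega> \<in> Bs ! j)}
    = ennreal ((if y 0 = x0 then 1 else 0) * (\<Prod>k<m. p (y k) (y (Suc k)))) * visit_prob p Bs (y m)"
proof (induction Bs arbitrary: m y)
  case Nil
  interpret prob_space M using mc unfolding markov_chain_from_def by blast
  from Nil mc show ?case by (simp add: emeasure_eq_measure markov_chain_from_def)
next
  case (Cons B Bs)
  interpret prob_space M using mc unfolding markov_chain_from_def by blast
  have meas [measurable]: "Z n \<in> measurable M (count_space S)" for n
    using mc unfolding markov_chain_from_def by blast
  have B: "B \<subseteq> S" "countable B" using Cons.prems S countable_subset by auto
  define y' where "y' v = y(Suc m := v)" for v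
  define X where "X v = {\<omega> \<in> space M. (\<forall>k\<le>Suc m. Z k \<omega> = y' v k) \<and>
      (\<forall>j<length Bs. Z (Suc (Suc m + j)) \<omega> \<in> Bs ! j)}" for v
  have y'S: "\<forall>k\<le>Suc m. y' v k \<in> S" if "v \<in> B" for v
    using that B Cons.prems(1) by (auto simp: y'_def le_Suc_eq)
  have Xm: "X v \<in> sets M" if "v \<in> B" for v
  proof -
    have [measurable]: "{y' v k} \<in> sets (count_space S)" if "k \<le> Suc m" for k
      using y'S[OF \<open>v \<in> B\<close>] that by auto
    have [measurable]: "Bs ! j \<in> sets (count_space S)" if "j < length Bs" for j
      using Cons.prems(2) that by auto
    have "X v = {\<omega> \<in> space M. (\<forall>k\<in>{..Suc m}. Z k \<omega> \<in> {y' v k}) \<and>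
        (\<forall>j\<in>{..<length Bs}. Z (Suc (Suc m + j)) \<omega> \<in> Bs ! j)}"
      unfolding X_def by auto
    also have "\<dots> \<in> sets M"
      by (intro sets.sets_Collect_conj sets.sets_Collect_finite_All measurable_sets_Collect[OF meas])
        (use y'S[OF that] Cons.prems(2) in \<open>auto intro!: measurable_sets_Collect[OF meas]\<close>)
    finally show ?thesis .
  qed
  have "{\<omega> \<in> space M. (\<forall>k\<le>m. Z k \<omega> = y k) \<and> (\<forall>j<length (B # Bs). Z (Suc (m + j)) \<omega> \<in> (B # Bs) ! j)}
      = (\<Union>v\<in>B. X v)"
  proof (intro set_eqI iffI)
    fix \<omega>
    assume "\<omega> \<in> {\<omega> \<in> space M. (\<forall>k\<le>m. Z k \<omega> = y k) \<and> (\<forall>j<length (B # Bs). Z (Suc (m + j)) \<omega> \<in> (B # Bs) ! j)}"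
    then have w: "\<omega> \<in> space M" "\<forall>k\<le>m. Z k \<omega> = y k" and *: "\<forall>j<Suc (length Bs). Z (Suc (m + j)) \<omega> \<in> (B # Bs) ! j"
      by auto
    have "Z (Suc m) \<omega> \<in> B" using *[rule_format, of 0] by simp
    moreover have "\<forall>j<length Bs. Z (Suc (Suc m + j)) \<omega> \<in> Bs ! j"
      using *[rule_format, of "Suc _"] by simp
    ultimately show "\<omega> \<in> (\<Union>v\<in>B. X v)" using w
      by (auto simp: X_def y'_def le_Suc_eq intro!: bexI[of _ "Z (Suc m) \<omega>"])
  next
    fix \<omega> assume "\<omega> \<in> (\<Union>v\<in>B. X v)"
    then obtain v where v: "v \<in> B" "\<omega> \<in> space M" "\<And>k. k \<le> Suc m \<Longrightarrow> Z k \<omega> = y' v k"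
      "\<And>j. j < length Bs \<Longrightarrow> Z (Suc (Suc m + j)) \<omega> \<in> Bs ! j" unfolding X_def by auto
    have "Z (Suc (m + j)) \<omega> \<in> (B # Bs) ! j" if "j < length (B # Bs)" for j
      using that v(1) v(3)[of "Suc m"] v(4)[of "j - 1"] by (cases j) (auto simp: y'_def)
    moreover have "Z k \<omega> = y k" if "k \<le> m" for k using v(3)[of k] that by (auto simp: y'_def)
    ultimately show "\<omega> \<in> {\<omega> \<in> space M. (\<forall>k\<le>m. Z k \<omega> = y k) \<and> (\<forall>j<length (B # Bs). Z (Suc (m + j)) \<omega> \<in> (B # Bs) ! j)}"
      using v(2) by blast
  qed
  also have "emeasure M (\<Union>v\<in>B. X v) = (\<integral>\<^sup>+v. emeasure M (X v) \<partial>count_space B)"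
  proof (rule emeasure_UN_countable[OF Xm B(2)])
    show "disjoint_family_on X B"
      unfolding disjoint_family_on_def X_def y'_def by (auto dest!: spec[of _ "Suc m"])
  qed
  also have "\<dots> = (\<integral>\<^sup>+v. ennreal ((if y 0 = x0 then 1 else 0) * (\<Prod>k<m. p (y k) (y (Suc k)))) *
      (ennreal (p (y m) v) * visit_prob p Bs v) \<partial>count_space B)"
  proof (intro nn_integral_cong, simp only: space_count_space)
    fix v assume v: "v \<in> B"
    have "emeasure M (X v) = ennreal ((if y' v 0 = x0 then 1 else 0) * (\<Prod>k<Suc m. p (y' v k) (y' v (Suc k))))
        * visit_prob p Bs (y' v (Suc m))"
      unfolding X_def by (rule Cons.IH[OF y'S[OF v]]) (use Cons.prems(2) in auto)
    also have "y' v (Suc m) = v" by (simp add: y'_def)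
    also have "(\<Prod>k<Suc m. p (y' v k) (y' v (Suc k))) = (\<Prod>k<m. p (y k) (y (Suc k))) * p (y m) v"
      by (simp add: y'_def)
    also have "y' v 0 = y 0" by (simp add: y'_def)
    finally show "emeasure M (X v) = ennreal ((if y 0 = x0 then 1 else 0) * (\<Prod>k<m. p (y k) (y (Suc k)))) *
      (ennreal (p (y m) v) * visit_prob p Bs v)"
      using nn[of "y m" v] subsetD[OF B(1) v] Cons.prems(1)
      by (auto simp: ennreal_mult'' mult.assoc)
  qed
  also have "\<dots> = ennreal ((if y 0 = x0 then 1 else 0) * (\<Prod>k<m. p (y k) (y (Suc k)))) * visit_prob p (B # Bs) (y m)"
    by (simp add: nn_integral_cmult)
  finally show ?case .
qed

lemma markov_chain_start:
  assumes mc: "markov_chain_from M S p x0 Z" and S: "countable S"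
    and nn: "\<And>x y. x \<in> S \<Longrightarrow> y \<in> S \<Longrightarrow> 0 \<le> p x y" and x0: "x0 \<in> S"
    and Bs: "\<forall>B\<in>set Bs. B \<subseteq> S"
  shows "emeasure M {\<omega> \<in> space M. \<forall>j<length Bs. Z (Suc j) \<omega> \<in> Bs ! j} = visit_prob p Bs x0"
    and "{\<omega> \<in> space M. \<forall>j<length Bs. Z (Suc j) \<omega> \<in> Bs ! j} \<in> sets M"
proof -
  interpret prob_space M using mc unfolding markov_chain_from_def by blast
  have meas: "Z n \<in> measurable M (count_space S)" for n
    using mc unfolding markov_chain_from_def by blast
  have "{\<omega> \<in> space M. \<forall>j<length Bs. Z (Suc j) \<omega> \<in> Bs ! j} =
      {\<omega> \<in> space M. \<forall>j\<in>{..<length Bs}. Z (Suc j) \<omega> \<in> Bs ! j}" by auto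
  also have "\<dots> \<in> sets M"
    by (intro sets.sets_Collect_finite_All) (use Bs in \<open>auto intro!: measurable_sets_Collect[OF meas]\<close>)
  finally show *: "{\<omega> \<in> space M. \<forall>j<length Bs. Z (Suc j) \<omega> \<in> Bs ! j} \<in> sets M" .
  have "emeasure M {\<omega> \<in> space M. Z 0 \<omega> = x0} = 1"
    using markov_chain_visits[OF mc S nn, of 0 "\<lambda>_. x0" "[]"] x0 by simp
  \<comment> \<open>The law prescribes the start, but \<open>Z 0 \<omega> = x0\<close> holds only almost surely.\<close>
  then have "AE \<omega> in M. Z 0 \<omega> = x0"
    using meas[of 0] x0 by (intro AE_I_eq_1) (auto intro!: measurable_sets_Collect[OF meas, of "\<lambda>x. x = x0"])
  then have "emeasure M {\<omega> \<in> space M. \<forall>j<length Bs. Z (Suc j) \<omega> \<in> Bs ! j} =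
      emeasure M {\<omega> \<in> space M. (\<forall>k\<le>0. Z k \<omega> = x0) \<and> (\<forall>j<length Bs. Z (Suc (0 + j)) \<omega> \<in> Bs ! j)}"
  proof (intro emeasure_eq_AE *)
    have "{\<omega> \<in> space M. (\<forall>k\<le>0. Z k \<omega> = x0) \<and> (\<forall>j<length Bs. Z (Suc (0 + j)) \<omega> \<in> Bs ! j)} =
        {\<omega> \<in> space M. Z 0 \<omega> = x0} \<inter> {\<omega> \<in> space M. \<forall>j<length Bs. Z (Suc j) \<omega> \<in> Bs ! j}"
      by (simp add: set_eq_iff conj_ac)
    also have "\<dots> \<in> sets M"
      by (intro sets.Int * measurable_sets_Collect[OF meas]) (use x0 in auto)
    finally show "{\<omega> \<in> space M. (\<forall>k\<le>0. Z k \<omega> = x0) \<and> (\<forall>j<length Bs. Z (Suc (0 + j)) \<omega> \<in> Bs ! j)} \<in> sets M" .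
  next
    assume "AE \<omega> in M. Z 0 \<omega> = x0"
    then show "AE \<omega> in M. (\<omega> \<in> {\<omega> \<in> space M. \<forall>j<length Bs. Z (Suc j) \<omega> \<in> Bs ! j}) =
        (\<omega> \<in> {\<omega> \<in> space M. (\<forall>k\<le>0. Z k \<omega> = x0) \<and> (\<forall>j<length Bs. Z (Suc (0 + j)) \<omega> \<in> Bs ! j)})"
      by eventually_elim simp
  qed
  also have "\<dots> = visit_prob p Bs x0"
    by (subst markov_chain_visits[OF mc S nn]) (use x0 Bs in auto)
  finally show "emeasure M {\<omega> \<in> space M. \<forall>j<length Bs. Z (Suc j) \<omega> \<in> Bs ! j} = visit_prob p Bs x0" .
qed

lemma visit_prob_kpow:
  "y \<in> S \<Longrightarrow> visit_prob p (replicate n S @ [{y}]) x = kpow S (\<lambda>x y. ennreal (p x y)) (Suc n) x y"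
proof (induction n arbitrary: x)
  case 0
  then show ?case by (simp add: nn_integral_count_space_finite nn_integral_count_space_delta)
qed auto

lemma visit_prob_fpass:
  assumes e: "e \<in> S" "x \<noteq> e"
  shows "visit_prob p (replicate n (S - {e}) @ [{e}]) x = fpass S (\<lambda>x y. ennreal (p x y)) e (Suc n) x"
  using assms(2)
proof (induction n arbitrary: x)
  case 0
  then show ?case using e by (simp add: nn_integral_count_space_finite nn_integral_count_space_delta)
next
  case (Suc n)
  have "visit_prob p (replicate (Suc n) (S - {e}) @ [{e}]) x =
      (\<integral>\<^sup>+y. ennreal (p x y) * fpass S (\<lambda>x y. ennreal (p x y)) e (Suc n) y \<partial>count_space (S - {e}))"
    by (simp add: Suc.IH del: fpass.simps cong: nn_integral_cong_simp)
  also have "\<dots> = (\<integral>\<^sup>+y. ennreal (p x y) * fpass S (\<lambda>x y. ennreal (p x y)) e (Suc n) y \<partial>count_space S)"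
    by (rule nn_integral_count_space_eq) auto
  finally show ?case using Suc.prems by simp
qed

lemma markov_chain_marginal:
  assumes mc: "markov_chain_from M S p x0 Z" and S: "countable S"
    and nn: "\<And>x y. x \<in> S \<Longrightarrow> y \<in> S \<Longrightarrow> 0 \<le> p x y" and x0: "x0 \<in> S" and y: "y \<in> S"
  shows "emeasure M {\<omega> \<in> space M. Z n \<omega> = y} = kpow S (\<lambda>x y. ennreal (p x y)) n x0 y"
proof (cases n)
  case 0
  then show ?thesis using markov_chain_visits[OF mc S nn, of 0 "\<lambda>_. y" "[]"] y by auto
next
  case (Suc m)
  have ZS: "Z k \<omega> \<in> S" if "\<omega> \<in> space M" for k \<omega>
    using mc that unfolding markov_chain_from_def by (auto dest!: measurable_space)
  have "{\<omega> \<in> space M. Z n \<omega> = y} = {\<omega> \<in> space M. \<forall>j<length (replicate m S @ [{y}]).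
      Z (Suc j) \<omega> \<in> (replicate m S @ [{y}]) ! j}"
    using ZS by (auto simp: Suc nth_append less_Suc_eq)
  also have "emeasure M \<dots> = kpow S (\<lambda>x y. ennreal (p x y)) n x0 y"
    by (subst markov_chain_start(1)[OF mc S nn x0]) (use y Suc in \<open>auto simp: visit_prob_kpow simp del: kpow.simps\<close>)
  finally show ?thesis .
qed

lemma return_time_eq_enat:
  "0 < n \<Longrightarrow> return_time Z e \<omega> = enat n \<longleftrightarrow> Z n \<omega> = e \<and> (\<forall>k. 0 < k \<and> k < n \<longrightarrow> Z k \<omega> \<noteq> e)"
proof -
  assume n: "0 < n"
  let ?K = "{k. 0 < k \<and> Z k \<omega> = e}"
  show ?thesis
  proof
    assume a: "return_time Z e \<omega> = enat n"
    have ne: "?K \<noteq> {}"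
    proof
      assume "?K = {}"
      then have "return_time Z e \<omega> = \<infinity>" by (simp only: return_time_def image_empty Inf_empty top_enat_def)
      with a show False by simp
    qed
    obtain k where "k \<in> ?K" using ne by blast
    then have "Inf (enat ` ?K) \<in> enat ` ?K" by (intro wellorder_InfI[of "enat k"] imageI)
    then have "n \<in> ?K" using a unfolding return_time_def by auto
    moreover have "n \<le> k" if "k \<in> ?K" for k
    proof -
      have "Inf (enat ` ?K) \<le> enat k" using that by (intro Inf_lower) auto
      then show ?thesis using a unfolding return_time_def by simp
    qed
    ultimately show "Z n \<omega> = e \<and> (\<forall>k. 0 < k \<and> k < n \<longrightarrow> Z k \<omega> \<noteq> e)" by force
  next
    assume b: "Z n \<omega> = e \<and> (\<forall>k. 0 < k \<and> k < n \<longrightarrow> Z k \<omega> \<noteq> e)"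
    show "return_time Z e \<omega> = enat n" unfolding return_time_def
    proof (rule antisym)
      show "Inf (enat ` ?K) \<le> enat n" using b n by (intro Inf_lower) auto
      show "enat n \<le> Inf (enat ` ?K)" by (rule Inf_greatest) (use b leI in auto)
    qed
  qed
qed

text \<open>A first return at time \<open>n + 2\<close> means that the positions \<open>1, \<dots>, n + 1\<close> avoid \<open>e\<close> and the next one
is \<open>e\<close>. Time \<open>1\<close> is excluded automatically, since a first step to \<open>e\<close> lies in \<open>A\<close>.\<close>

lemma first_return_probability:
  assumes mc: "markov_chain_from M S p e Z" and S: "countable S"
    and nn: "\<And>x y. x \<in> S \<Longrightarrow> y \<in> S \<Longrightarrow> 0 \<le> p x y" and e: "e \<in> S" "e \<in> A"
  shows "emeasure M {\<omega> \<in> space M. return_time Z e \<omega> = enat (Suc (Suc n)) \<and> Z 1 \<omega> \<notin> A} =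
    (\<integral>\<^sup>+y. ennreal (p e y) * fpass S (\<lambda>x y. ennreal (p x y)) e (Suc n) y \<partial>count_space (S - A))"
proof -
  let ?B = "(S - A) # replicate n (S - {e}) @ [{e}]"
  have ZS: "Z k \<omega> \<in> S" if "\<omega> \<in> space M" for k \<omega>
    using mc that unfolding markov_chain_from_def by (auto dest!: measurable_space)
  have "{\<omega> \<in> space M. return_time Z e \<omega> = enat (Suc (Suc n)) \<and> Z 1 \<omega> \<notin> A} =
      {\<omega> \<in> space M. \<forall>j<length ?B. Z (Suc j) \<omega> \<in> ?B ! j}" (is "?L = ?R")
  proof (intro set_eqI iffI)
    fix \<omega> assume "\<omega> \<in> ?L"
    then have w: "\<omega> \<in> space M" "Z 1 \<omega> \<notin> A" "Z (Suc (Suc n)) \<omega> = e" "\<And>k. 0 < k \<Longrightarrow> k < Suc (Suc n) \<Longrightarrow> Z k \<omega> \<noteq> e"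
      by (auto simp: return_time_eq_enat)
    have "Z (Suc j) \<omega> \<in> ?B ! j" if "j < length ?B" for j
    proof (cases j)
      case 0
      then show ?thesis using w(2) ZS[OF w(1)] by simp
    next
      case (Suc i)
      show ?thesis
      proof (cases "i < n")
        case True
        then show ?thesis using w(4)[of "Suc j"] ZS[OF w(1)] Suc by (simp add: nth_append)
      next
        case False
        then have "i = n" using Suc that by simp
        then show ?thesis using w(3) Suc by (simp add: nth_append)
      qed
    qed
    with w(1) show "\<omega> \<in> ?R" by blast
  next
    fix \<omega> assume "\<omega> \<in> ?R"
    then have w: "\<omega> \<in> space M" and *: "\<And>j. j < Suc (Suc n) \<Longrightarrow> Z (Suc j) \<omega> \<in> ?B ! j" by auto
    have 1: "Z 1 \<omega> \<notin> A" using *[of 0] by simp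
    have 2: "Z (Suc (Suc n)) \<omega> = e" using *[of "Suc n"] by (simp add: nth_append)
    have "Z k \<omega> \<noteq> e" if k: "0 < k" "k < Suc (Suc n)" for k
    proof (cases "k = 1")
      case True then show ?thesis using 1 e by auto
    next
      case False
      then obtain j where "k = Suc (Suc j)" "j < n" using k by (cases k; cases "k - 1") auto
      then show ?thesis using *[of "Suc j"] by (auto simp: nth_append)
    qed
    with w 1 2 show "\<omega> \<in> ?L" by (auto simp: return_time_eq_enat)
  qed
  also have "emeasure M \<dots> = visit_prob p ?B e"
    by (rule markov_chain_start(1)[OF mc S nn e(1)]) (use e in auto)
  also have "\<dots> = (\<integral>\<^sup>+y. ennreal (p e y) * fpass S (\<lambda>x y. ennreal (p x y)) e (Suc n) y \<partial>count_space (S - A))"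
    unfolding visit_prob.simps
    by (intro nn_integral_cong arg_cong2[where f = "(*)"] refl visit_prob_fpass) (use e in auto)
  finally show ?thesis .
qed

lemma first_return_series:
  assumes mc: "markov_chain_from M S p e Z" and S: "countable S"
    and nn: "\<And>x y. x \<in> S \<Longrightarrow> y \<in> S \<Longrightarrow> 0 \<le> p x y" and e: "e \<in> S" "e \<in> A" and z: "0 \<le> z"
  shows "(\<Sum>n. ennreal (if 2 \<le> n then measure M {\<omega> \<in> space M. return_time Z e \<omega> = enat n \<and> Z 1 \<omega> \<notin> A} * z ^ n else 0))
    = (\<integral>\<^sup>+y. ennreal (z * p e y) * hit S (\<lambda>x y. ennreal (z * p x y)) e y \<partial>count_space (S - A))"
    (is "(\<Sum>n. ?h n) = _")
proof -
  interpret prob_space M using mc unfolding markov_chain_from_def by blast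
  let ?q = "\<lambda>x y. ennreal (z * p x y)"
  have h: "?h (Suc (Suc n)) = (\<integral>\<^sup>+y. ?q e y * fpass S ?q e (Suc n) y \<partial>count_space (S - A))" for n
  proof -
    have "?h (Suc (Suc n)) = ennreal (z ^ Suc (Suc n)) *
        (\<integral>\<^sup>+y. ennreal (p e y) * fpass S (\<lambda>x y. ennreal (p x y)) e (Suc n) y \<partial>count_space (S - A))"
      using z by (simp add: emeasure_eq_measure[symmetric] first_return_probability[OF mc S nn e, symmetric] ennreal_mult' mult_ac
        del: fpass.simps)
    also have "\<dots> = (\<integral>\<^sup>+y. ennreal (z ^ Suc (Suc n)) * (ennreal (p e y) * fpass S (\<lambda>x y. ennreal (p x y)) e (Suc n) y) \<partial>count_space (S - A))"
      by (rule nn_integral_cmult[symmetric]) simp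
    also have "\<dots> = (\<integral>\<^sup>+y. ?q e y * fpass S ?q e (Suc n) y \<partial>count_space (S - A))"
      unfolding fpass_scale[OF z] using z nn e
      by (auto intro!: nn_integral_cong simp: ennreal_mult' ennreal_mult'' mult_ac simp del: fpass.simps)
    finally show ?thesis .
  qed
  have "(\<Sum>n. ?h n) = (\<Sum>n. ?h (Suc (Suc n)))"
    by (subst suminf_split_first, subst suminf_split_first) simp
  also have "\<dots> = (\<integral>\<^sup>+y. (\<Sum>n. ?q e y * fpass S ?q e (Suc n) y) \<partial>count_space (S - A))"
    unfolding h by (rule nn_integral_suminf[symmetric]) simp
  also have "\<dots> = (\<integral>\<^sup>+y. ?q e y * hit S ?q e y \<partial>count_space (S - A))"
  proof (intro nn_integral_cong)
    fix y assume "y \<in> space (count_space (S - A))"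
    then have "y \<noteq> e" using e by auto
    then have "hit S ?q e y = (\<Sum>n. fpass S ?q e (Suc n) y)"
      unfolding hit_def by (subst suminf_split_first) simp
    then show "(\<Sum>n. ?q e y * fpass S ?q e (Suc n) y) = ?q e y * hit S ?q e y"
      by (simp del: fpass.simps)
  qed
  finally show ?thesis .
qed

section \<open>The free product and its transition operator\<close>

locale free_walk =
  fixes r :: nat and V :: "nat \<Rightarrow> 'a set" and rt :: "nat \<Rightarrow> 'a"
    and p :: "nat \<Rightarrow> 'a \<Rightarrow> 'a \<Rightarrow> real" and \<alpha> :: "nat \<Rightarrow> real"
  assumes r2: "2 \<le> r"
    and V_countable: "\<And>i. i \<in> {1..r} \<Longrightarrow> countable (V i)"
    and V_disjoint: "disjoint_family_on V {1..r}"
    and rt_in: "\<And>i. i \<in> {1..r} \<Longrightarrow> rt i \<in> V i"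
    and p_trans: "\<And>i. i \<in> {1..r} \<Longrightarrow> transition_matrix (V i) (p i)"
    and p_diag: "\<And>i x. i \<in> {1..r} \<Longrightarrow> x \<in> V i \<Longrightarrow> p i x x = 0"
    and \<alpha>_pos: "\<And>i. i \<in> {1..r} \<Longrightarrow> \<alpha> i > 0"
    and \<alpha>_sum: "(\<Sum>i\<in>{1..r}. \<alpha> i) = 1"
begin

abbreviation "I \<equiv> {1..r}"
abbreviation "W \<equiv> free_product r V rt"
abbreviation "P \<equiv> walk_matrix r V rt p \<alpha>"

text \<open>For every \<open>i\<close> a word is in exactly one copy of \<open>V i\<close>: it is \<open>app (rt i) b v\<close> for a unique word \<open>b\<close> not
ending in \<open>V i\<close> and a unique \<open>v\<close>. A word that does not end in \<open>V i\<close> is the root of its copy.\<close>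

definition pos :: "nat \<Rightarrow> 'a list \<Rightarrow> 'a" where
  "pos i x = (if x \<noteq> [] \<and> last x \<in> V i then last x else rt i)"

definition base :: "nat \<Rightarrow> 'a list \<Rightarrow> 'a list" where
  "base i x = (if x \<noteq> [] \<and> last x \<in> V i then butlast x else x)"

lemma factor_unique: "i \<in> I \<Longrightarrow> j \<in> I \<Longrightarrow> v \<in> V i \<Longrightarrow> v \<in> V j \<Longrightarrow> i = j"
  using V_disjoint unfolding disjoint_family_on_def by blast

lemma factor_unique': "Suc 0 \<le> i \<Longrightarrow> i \<le> r \<Longrightarrow> Suc 0 \<le> j \<Longrightarrow> j \<le> r \<Longrightarrow> v \<in> V i \<Longrightarrow> v \<in> V j \<Longrightarrow> i = j"
  using factor_unique by auto

lemma p_nonneg: "i \<in> I \<Longrightarrow> v \<in> V i \<Longrightarrow> w \<in> V i \<Longrightarrow> 0 \<le> p i v w"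
  using p_trans unfolding transition_matrix_def by blast

lemma Nil_in_W [simp]: "[] \<in> W"
  by (simp add: free_product_def)

lemma snoc_in_W_iff:
  "x @ [v] \<in> W \<longleftrightarrow> x \<in> W \<and> (\<exists>i\<in>I. v \<in> V i - {rt i} \<and> (x = [] \<or> last x \<notin> V i))"
  unfolding free_product_def by (auto simp: successively_append_iff) (metis factor_unique')

lemma Cons_in_W_iff:
  "v # x \<in> W \<longleftrightarrow> x \<in> W \<and> (\<exists>i\<in>I. v \<in> V i - {rt i} \<and> (x = [] \<or> hd x \<notin> V i))"
  unfolding free_product_def by (cases x) (auto, metis factor_unique')

lemma W_countable: "countable W"
proof (rule countable_subset)
  show "W \<subseteq> lists (\<Union>i\<in>I. V i)" unfolding free_product_def by auto
  show "countable (lists (\<Union>i\<in>I. V i))" using V_countable by (intro countable_lists countable_UN) auto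
qed

lemma app_in_W:
  "b \<in> W \<Longrightarrow> b = [] \<or> last b \<notin> V i \<Longrightarrow> i \<in> I \<Longrightarrow> w \<in> V i \<Longrightarrow> app (rt i) b w \<in> W"
  by (auto simp: app_def snoc_in_W_iff)

lemma base_pos:
  assumes "x \<in> W" "i \<in> I"
  shows "base i x \<in> W" "base i x = [] \<or> last (base i x) \<notin> V i" "pos i x \<in> V i"
    "app (rt i) (base i x) (pos i x) = x"
proof -
  have "base i x \<in> W \<and> (base i x = [] \<or> last (base i x) \<notin> V i) \<and> pos i x \<in> V i \<and> app (rt i) (base i x) (pos i x) = x"
  proof (cases "x \<noteq> [] \<and> last x \<in> V i")
    case True
    then obtain b v where x: "x = b @ [v]" "v \<in> V i" by (metis append_butlast_last_id)
    then obtain j where j: "j \<in> I" "v \<in> V j - {rt j}" "b = [] \<or> last b \<notin> V j" "b \<in> W"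
      using assms by (auto simp: snoc_in_W_iff)
    then have "j = i" using factor_unique[of j i v] x assms by auto
    with j x show ?thesis unfolding base_def pos_def app_def by auto
  next
    case False
    then show ?thesis using assms rt_in by (auto simp: base_def pos_def app_def)
  qed
  then show "base i x \<in> W" "base i x = [] \<or> last (base i x) \<notin> V i" "pos i x \<in> V i"
    "app (rt i) (base i x) (pos i x) = x" by auto
qed

lemma base_pos_app:
  assumes "i \<in> I" "b = [] \<or> last b \<notin> V i" "w \<in> V i"
  shows "base i (app (rt i) b w) = b" "pos i (app (rt i) b w) = w"
  using assms by (auto simp: base_def pos_def app_def)

lemma app_eq_iff: "app e b v = app e b w \<longleftrightarrow> v = w"
  by (auto simp: app_def)

lemma lifted_row:
  assumes "x \<in> W" "i \<in> I" "w \<in> V i"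
  shows "lifted r V rt p i x (app (rt i) (base i x) w) = p i (pos i x) w"
  using lifted_app[of "pos i x" V i w "base i x" r rt p] base_pos[OF assms(1,2)] assms(3) by simp

lemma lifted_col:
  assumes "y \<in> W" "i \<in> I" "w \<in> V i"
  shows "lifted r V rt p i (app (rt i) (base i y) w) y = p i w (pos i y)"
  using lifted_app[of w V i "pos i y" "base i y" r rt p] base_pos[OF assms(1,2)] assms(3) by simp

lemma lifted_eq_0:
  assumes "i \<in> I" and "y \<notin> app (rt i) (base i x) ` V i \<or> x \<notin> app (rt i) (base i y) ` V i"
  shows "lifted r V rt p i x y = 0"
proof -
  have "\<not> lift_pair r V rt i x y v w" for v w
  proof
    assume "lift_pair r V rt i x y v w"
    then obtain b where b: "v \<in> V i" "w \<in> V i" "b = [] \<or> last b \<notin> V i"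
      "x = app (rt i) b v" "y = app (rt i) b w" unfolding lift_pair_def by blast
    then show False using assms base_pos_app[OF assms(1) b(3)] by auto
  qed
  then have "\<not> (\<exists>v w. lift_pair r V rt i x y v w)" by blast
  then show ?thesis unfolding lifted_def by (rule if_not_P)
qed

lemma lifted_nonneg: "i \<in> I \<Longrightarrow> x \<in> W \<Longrightarrow> 0 \<le> lifted r V rt p i x y"
  using lifted_eq_0[of i y x] lifted_row[of x i] p_nonneg[of i "pos i x"] base_pos(3)[of x i]
  by (cases "y \<in> app (rt i) (base i x) ` V i") auto

lemma P_nonneg: "x \<in> W \<Longrightarrow> 0 \<le> P x y"
  unfolding walk_matrix_def by (intro sum_nonneg mult_nonneg_nonneg lifted_nonneg less_imp_le[OF \<alpha>_pos]) auto

lemma nn_integral_copy: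
  assumes "b \<in> W" "b = [] \<or> last b \<notin> V i" "i \<in> I" and "\<And>y. y \<notin> app (rt i) b ` V i \<Longrightarrow> g y = (0::ennreal)"
  shows "(\<integral>\<^sup>+y. g y \<partial>count_space W) = (\<integral>\<^sup>+w. g (app (rt i) b w) \<partial>count_space (V i))"
proof -
  have "(\<integral>\<^sup>+y. g y \<partial>count_space W) = (\<integral>\<^sup>+y. g y \<partial>count_space (app (rt i) b ` V i))"
    by (rule nn_integral_count_space_eq) (use assms app_in_W in auto)
  also have "\<dots> = (\<integral>\<^sup>+w. g (app (rt i) b w) \<partial>count_space (V i))"
    by (rule nn_integral_bij_count_space[symmetric]) (auto simp: bij_betw_def inj_on_def app_eq_iff)
  finally show ?thesis .
qed

lemma P_ennreal:
  assumes "x \<in> W" "0 \<le> z"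
  shows "ennreal (z * P x y) = (\<Sum>i\<in>I. ennreal (z * \<alpha> i * lifted r V rt p i x y))"
  unfolding walk_matrix_def sum_distrib_left
  using assms lifted_nonneg less_imp_le[OF \<alpha>_pos] by (subst sum_ennreal) (auto simp: mult.assoc)

text \<open>A step of the walk selects a factor and moves within the copy of this factor that contains the
present word.\<close>

lemma row_operator:
  assumes x: "x \<in> W" and z: "0 \<le> z"
  shows "(\<integral>\<^sup>+y. ennreal (z * P x y) * f y \<partial>count_space W) =
    (\<Sum>i\<in>I. \<integral>\<^sup>+w. ennreal (z * \<alpha> i * p i (pos i x) w) * f (app (rt i) (base i x) w) \<partial>count_space (V i))"
proof -
  have "(\<integral>\<^sup>+y. ennreal (z * P x y) * f y \<partial>count_space W) =
      (\<Sum>i\<in>I. \<integral>\<^sup>+y. ennreal (z * \<alpha> i * lifted r V rt p i x y) * f y \<partial>count_space W)"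
    unfolding P_ennreal[OF x z] sum_distrib_right by (rule nn_integral_sum) simp
  also have "\<dots> = (\<Sum>i\<in>I. \<integral>\<^sup>+w. ennreal (z * \<alpha> i * p i (pos i x) w) * f (app (rt i) (base i x) w) \<partial>count_space (V i))"
  proof (rule sum.cong[OF refl])
    fix i assume i: "i \<in> I"
    show "(\<integral>\<^sup>+y. ennreal (z * \<alpha> i * lifted r V rt p i x y) * f y \<partial>count_space W) =
        (\<integral>\<^sup>+w. ennreal (z * \<alpha> i * p i (pos i x) w) * f (app (rt i) (base i x) w) \<partial>count_space (V i))"
      by (subst nn_integral_copy[OF base_pos(1,2)[OF x i] i])
        (auto simp: lifted_eq_0[OF i] lifted_row[OF x i] intro!: nn_integral_cong)
  qed
  finally show ?thesis .
qed

lemma col_operator: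
  assumes y: "y \<in> W" and z: "0 \<le> z"
  shows "(\<integral>\<^sup>+x. f x * ennreal (z * P x y) \<partial>count_space W) =
    (\<Sum>i\<in>I. \<integral>\<^sup>+w. f (app (rt i) (base i y) w) * ennreal (z * \<alpha> i * p i w (pos i y)) \<partial>count_space (V i))"
proof -
  have "(\<integral>\<^sup>+x. f x * ennreal (z * P x y) \<partial>count_space W) =
      (\<integral>\<^sup>+x. (\<Sum>i\<in>I. f x * ennreal (z * \<alpha> i * lifted r V rt p i x y)) \<partial>count_space W)"
    using z by (intro nn_integral_cong) (simp add: P_ennreal sum_distrib_left)
  also have "\<dots> = (\<Sum>i\<in>I. \<integral>\<^sup>+x. f x * ennreal (z * \<alpha> i * lifted r V rt p i x y) \<partial>count_space W)"
    by (rule nn_integral_sum) simp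
  also have "\<dots> = (\<Sum>i\<in>I. \<integral>\<^sup>+w. f (app (rt i) (base i y) w) * ennreal (z * \<alpha> i * p i w (pos i y)) \<partial>count_space (V i))"
  proof (rule sum.cong[OF refl])
    fix i assume i: "i \<in> I"
    show "(\<integral>\<^sup>+x. f x * ennreal (z * \<alpha> i * lifted r V rt p i x y) \<partial>count_space W) =
        (\<integral>\<^sup>+w. f (app (rt i) (base i y) w) * ennreal (z * \<alpha> i * p i w (pos i y)) \<partial>count_space (V i))"
      by (subst nn_integral_copy[OF base_pos(1,2)[OF y i] i])
        (auto simp: lifted_eq_0[OF i] lifted_col[OF y i] intro!: nn_integral_cong)
  qed
  finally show ?thesis .
qed

lemma factor_row_sum:
  assumes "i \<in> I" "v \<in> V i" "0 \<le> s"
  shows "(\<integral>\<^sup>+w. ennreal (s * p i v w) \<partial>count_space (V i)) = ennreal s"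
  using transition_matrix_sum[OF p_trans assms(2)] assms by (simp add: ennreal_mult' nn_integral_cmult)

lemma P_transition: "transition_matrix W P"
  unfolding transition_matrix_def
proof (intro ballI conjI)
  fix x assume x: "x \<in> W"
  show "0 \<le> P x y" for y using P_nonneg[OF x] .
  have "(\<integral>\<^sup>+y. ennreal (P x y) \<partial>count_space W) =
      (\<Sum>i\<in>I. \<integral>\<^sup>+w. ennreal (\<alpha> i * p i (pos i x) w) \<partial>count_space (V i))"
    using row_operator[OF x, of 1 "\<lambda>_. 1"] by simp
  also have "\<dots> = (\<Sum>i\<in>I. ennreal (\<alpha> i))"
    using base_pos(3)[OF x] \<alpha>_pos by (intro sum.cong factor_row_sum) (auto simp: less_imp_le)
  also have "\<dots> = 1" using \<alpha>_pos \<alpha>_sum by (subst sum_ennreal) (auto simp: less_imp_le)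
  finally have 1: "(\<integral>\<^sup>+y. ennreal (P x y) \<partial>count_space W) = 1" .
  then have "integrable (count_space W) (P x)"
    using P_nonneg[OF x] by (intro integrableI_nonneg) (auto simp: AE_count_space)
  then have "P x summable_on W"
    by (simp add: abs_summable_on_def[symmetric] abs_summable_equivalent[symmetric] abs_summable_summable)
  moreover from nn_integral_eq_infsum[OF this P_nonneg[OF x]] 1 have "infsum (P x) W = 1"
    by simp
  ultimately show "(P x has_sum 1) W" using has_sum_infsum by fastforce
qed

end

section \<open>The factors\<close>

context free_walk
begin

abbreviation "qs i s \<equiv> \<lambda>v w. ennreal (s * p i v w)"

definition Gr :: "nat \<Rightarrow> real \<Rightarrow> real" where
  "Gr i s = green (V i) (p i) (rt i) (rt i) s"

text \<open>The total weight at \<open>s\<close> of the paths in the factor from the root to anywhere else that do not return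
to the root; see \<open>L_sum\<close>.\<close>

definition A :: "nat \<Rightarrow> real \<Rightarrow> real" where
  "A i s = 1 / ((1 - s) * Gr i s) - 1"

text \<open>By the decomposition at the last visit to the root, this quotient is the generating function of the
paths from the root to \<open>v\<close> without a return to the root.\<close>

definition L :: "nat \<Rightarrow> real \<Rightarrow> 'a \<Rightarrow> ennreal" where
  "L i s v = kgreen (V i) (qs i s) (rt i) v / kgreen (V i) (qs i s) (rt i) (rt i)"

lemma nstep_factor: "i \<in> I \<Longrightarrow> 0 \<le> nstep (V i) (p i) n (rt i) (rt i) \<and> nstep (V i) (p i) n (rt i) (rt i) \<le> 1"
  using nstep_bounds_and_kpow[OF p_trans rt_in] by blast

lemma summable_factor:
  assumes "i \<in> I" "0 \<le> s" "s < 1"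
  shows "summable (\<lambda>n. nstep (V i) (p i) n (rt i) (rt i) * s ^ n)"
  using nstep_factor[OF assms(1)] assms
  by (intro summable_comparison_test'[OF summable_geometric[of s], of 0])
    (auto simp: abs_mult mult_left_le_one_le)

lemma kgreen_factor:
  "i \<in> I \<Longrightarrow> 0 \<le> s \<Longrightarrow> s < 1 \<Longrightarrow> kgreen (V i) (qs i s) (rt i) (rt i) = ennreal (Gr i s)"
  unfolding Gr_def by (intro kgreen_eq_green p_trans rt_in summable_factor)

lemma Gr_bounds:
  assumes "i \<in> I" "0 \<le> s" "s < 1"
  shows "1 \<le> Gr i s" "Gr i s \<le> 1 / (1 - s) - s"
proof -
  let ?c = "\<lambda>n. nstep (V i) (p i) n (rt i) (rt i)"
  have "ennreal 1 \<le> ennreal (Gr i s)" unfolding kgreen_factor[OF assms, symmetric] by (subst kgreen_left) simp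
  then show "1 \<le> Gr i s" by (simp add: ennreal_le_iff2)
  have "nstep (V i) (p i) (Suc 0) (rt i) (rt i) = 0"
    unfolding nstep.simps using p_diag[OF assms(1) rt_in[OF assms(1)]] by (intro infsum_0) auto
  then have c1: "?c 1 = 0" by simp
  have "Gr i s \<le> (\<Sum>n. s ^ n - (if n = 1 then s else 0))"
    unfolding Gr_def green_def
  proof (rule suminf_le[OF _ summable_factor[OF assms]])
    show "?c n * s ^ n \<le> s ^ n - (if n = 1 then s else 0)" for n
      using c1 nstep_factor[OF assms(1), of n] assms by (auto simp: mult_left_le_one_le)
    show "summable (\<lambda>n. s ^ n - (if n = 1 then s else 0))"
      using assms by (intro summable_diff summable_geometric) auto
  qed
  also have "\<dots> = (\<Sum>n. s ^ n) - (\<Sum>n. if n = 1 then s else 0)"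
    using assms by (intro suminf_diff[symmetric] summable_geometric) auto
  also have "\<dots> = 1 / (1 - s) - s"
    using assms suminf_geometric[of s] sums_unique[OF sums_single[of 1 "\<lambda>_. s"]] by simp
  finally show "Gr i s \<le> 1 / (1 - s) - s" .
qed

lemma Gr_deriv:
  assumes "i \<in> I" "0 \<le> s" "s < 1"
  shows "(Gr i has_real_derivative deriv (Gr i) s) (at s)"
proof -
  let ?c = "\<lambda>n. nstep (V i) (p i) n (rt i) (rt i)"
  have "(Gr i has_real_derivative (\<Sum>n. diffs ?c n * s ^ n)) (at s)"
    unfolding Gr_def[abs_def] green_def
    by (rule termdiffs_strong[OF summable_factor[of i "(s + 1) / 2"]]) (use assms in auto)
  then show ?thesis using DERIV_imp_deriv by fastforce
qed

lemma A_pos: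
  assumes "i \<in> I" "0 < s" "s < 1"
  shows "0 < A i s"
proof -
  have "(1 - s) * Gr i s \<le> (1 - s) * (1 / (1 - s) - s)"
    using Gr_bounds(2)[of i s] assms by (intro mult_left_mono) auto
  also have "\<dots> = 1 - (1 - s) * s" using assms by (simp add: right_diff_distrib)
  also have "\<dots> < 1" using assms by simp
  finally have "(1 - s) * Gr i s < 1" .
  moreover have "0 < (1 - s) * Gr i s" using Gr_bounds(1)[of i s] assms by auto
  ultimately show ?thesis unfolding A_def by (simp add: field_simps)
qed

lemma L_root: "i \<in> I \<Longrightarrow> 0 \<le> s \<Longrightarrow> s < 1 \<Longrightarrow> L i s (rt i) = 1"
  using Gr_bounds(1)[of i s] unfolding L_def by (subst ennreal_divide_self) (auto simp: kgreen_factor)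

lemma L_integral:
  "(\<integral>\<^sup>+w. qs i s w v * L i s w \<partial>count_space (V i)) =
    (\<integral>\<^sup>+w. kgreen (V i) (qs i s) (rt i) w * qs i s w v \<partial>count_space (V i)) / kgreen (V i) (qs i s) (rt i) (rt i)"
  unfolding L_def by (subst nn_integral_divide[symmetric]) (auto simp: ennreal_times_divide mult.commute)

lemma L_step:
  assumes "i \<in> I" "v \<in> V i" "v \<noteq> rt i"
  shows "(\<integral>\<^sup>+w. qs i s w v * L i s w \<partial>count_space (V i)) = L i s v"
proof -
  have "kgreen (V i) (qs i s) (rt i) v = (\<integral>\<^sup>+w. kgreen (V i) (qs i s) (rt i) w * qs i s w v \<partial>count_space (V i))"
    using assms by (subst kgreen_right[OF V_countable[OF assms(1)] rt_in[OF assms(1)]]) auto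
  then show ?thesis unfolding L_integral by (simp add: L_def)
qed

text \<open>The renewal equation at the root can be read off from the first or from the last step; since the
  Green function is finite, the two return generating functions agree.\<close>

lemma L_return:
  assumes i: "i \<in> I" and s: "0 \<le> s" "s < 1"
  shows "(\<integral>\<^sup>+w. qs i s w (rt i) * L i s w \<partial>count_space (V i)) =
    (\<integral>\<^sup>+w. qs i s (rt i) w * hit (V i) (qs i s) (rt i) w \<partial>count_space (V i))" (is "_ = ?U")
proof -
  let ?G = "kgreen (V i) (qs i s) (rt i) (rt i)"
  have fin: "?G < \<infinity>" "?G \<noteq> 0"
    using Gr_bounds(1)[OF i s] by (auto simp: kgreen_factor[OF i s])
  have "?G = 1 + (\<integral>\<^sup>+w. kgreen (V i) (qs i s) (rt i) w * qs i s w (rt i) \<partial>count_space (V i))"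
    by (subst kgreen_right[OF V_countable[OF i] rt_in[OF i] rt_in[OF i]]) simp
  moreover have "?G = 1 + ?U * ?G"
    by (rule kgreen_return_hit[OF rt_in[OF i] fin(1)])
  ultimately have "1 + (\<integral>\<^sup>+w. kgreen (V i) (qs i s) (rt i) w * qs i s w (rt i) \<partial>count_space (V i)) = 1 + ?U * ?G"
    by (rule trans[OF sym])
  then have "(\<integral>\<^sup>+w. kgreen (V i) (qs i s) (rt i) w * qs i s w (rt i) \<partial>count_space (V i)) = ?U * ?G"
    unfolding ennreal_add_left_cancel by simp
  then show ?thesis
    unfolding L_integral using fin by (simp add: ennreal_times_divide[symmetric] ennreal_divide_self)
qed

lemma L_sum:
  assumes i: "i \<in> I" and s: "0 < s" "s < 1"
  shows "(\<integral>\<^sup>+v. L i s v \<partial>count_space (V i - {rt i})) = ennreal (A i s)" (is "?X = _")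
proof -
  have s0: "0 \<le> s" using s by simp
  have g: "1 \<le> Gr i s" using Gr_bounds[of i s] i s by simp
  have "(\<integral>\<^sup>+v. L i s v \<partial>count_space (V i)) =
      (\<integral>\<^sup>+v. L i s v * indicator {rt i} v + L i s v * indicator (V i - {rt i}) v \<partial>count_space (V i))"
    by (intro nn_integral_cong) (auto split: split_indicator)
  also have "\<dots> = (\<integral>\<^sup>+v. L i s v * indicator {rt i} v \<partial>count_space (V i)) +
      (\<integral>\<^sup>+v. L i s v * indicator (V i - {rt i}) v \<partial>count_space (V i))"
    by (rule nn_integral_add) auto
  also have "(\<integral>\<^sup>+v. L i s v * indicator {rt i} v \<partial>count_space (V i)) = 1"
    using rt_in[OF i] L_root[OF i s0 s(2)] by simp
  also have "(\<integral>\<^sup>+v. L i s v * indicator (V i - {rt i}) v \<partial>count_space (V i)) = ?X"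
    by (subst (1 2) nn_integral_count_space_indicator) (auto intro!: nn_integral_cong split: split_indicator)
  also have "(\<integral>\<^sup>+v. L i s v \<partial>count_space (V i)) = ennreal (1 / (1 - s)) / ennreal (Gr i s)"
    unfolding L_def using kgreen_row_sum[OF p_trans[OF i] V_countable[OF i] rt_in[OF i] s0 s(2)]
    by (subst nn_integral_divide) (auto simp: kgreen_factor[OF i s0 s(2)])
  also have "\<dots> = ennreal (1 + A i s)"
    using s g by (subst divide_ennreal) (auto simp: A_def)
  also have "\<dots> = 1 + ennreal (A i s)" using A_pos[OF i s] by simp
  finally show ?thesis unfolding ennreal_add_left_cancel by simp
qed

text \<open>Every path from the root to another point has at least one step, so that its weight at \<open>s\<close>
  is at most \<open>s / t\<close> times its weight at \<open>t\<close>.\<close>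

lemma A_ratio_mono:
  assumes i: "i \<in> I" and s: "0 < s" "s \<le> t" "t < 1"
  shows "A i s / s \<le> A i t / t"
proof -
  have s': "0 \<le> s" "s < 1" "0 \<le> t" using s by auto
  \<comment> \<open>A supersolution at \<open>s\<close> built from the solution at \<open>t\<close>, normalised to \<open>1\<close> at the root.\<close>
  define h where "h v = (if v = rt i then 1 else ennreal (s / t) * L i t v)" for v
  have hL: "h w \<le> L i t w" if "w \<in> V i" for w
    using L_root[OF i s'(3) s(3)] s mult_right_mono[of "ennreal (s / t)" 1 "L i t w"]
    by (auto simp: h_def ennreal_le_1)
  have "kgreen (V i) (qs i s) (rt i) v \<le> kgreen (V i) (qs i s) (rt i) (rt i) * h v" if v: "v \<in> V i" for v
  proof (rule kgreen_le_supersolution_right[OF V_countable[OF i] rt_in[OF i] _ _ v])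
    fix y assume y: "y \<in> V i" "y \<noteq> rt i"
    have "(\<integral>\<^sup>+w. h w * qs i s w y \<partial>count_space (V i)) \<le> (\<integral>\<^sup>+w. L i t w * qs i s w y \<partial>count_space (V i))"
      by (intro nn_integral_mono mult_right_mono hL) auto
    also have "\<dots> = (\<integral>\<^sup>+w. ennreal (s / t) * (qs i t w y * L i t w) \<partial>count_space (V i))"
    proof (intro nn_integral_cong)
      fix w assume "w \<in> space (count_space (V i))"
      have "qs i s w y = ennreal (s / t * (t * p i w y))" using s by simp
      also have "\<dots> = ennreal (s / t) * qs i t w y" using s by (intro ennreal_mult') simp
      finally show "L i t w * qs i s w y = ennreal (s / t) * (qs i t w y * L i t w)" by (simp only: mult_ac)
    qed
    also have "\<dots> = h y" using y by (subst nn_integral_cmult) (auto simp: L_step[OF i] h_def)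
    finally show "(\<integral>\<^sup>+w. h w * qs i s w y \<partial>count_space (V i)) \<le> h y" .
  qed (simp add: h_def)
  then have Lh: "L i s v \<le> h v" if "v \<in> V i" for v
    unfolding L_def kgreen_factor[OF i s'(1,2)] using Gr_bounds(1)[OF i s'(1,2)] that
    by (intro divide_le_posI_ennreal) (auto simp: kgreen_factor[OF i s'(1,2)] mult.commute)
  have "ennreal (A i s) \<le> (\<integral>\<^sup>+v. h v \<partial>count_space (V i - {rt i}))"
    unfolding L_sum[OF i s(1) s'(2), symmetric] by (intro nn_integral_mono Lh) auto
  also have "\<dots> = (\<integral>\<^sup>+v. ennreal (s / t) * L i t v \<partial>count_space (V i - {rt i}))"
    by (intro nn_integral_cong) (auto simp: h_def)
  also have "\<dots> = ennreal (s / t) * ennreal (A i t)"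
    using s by (subst nn_integral_cmult) (auto simp: L_sum[OF i])
  also have "\<dots> = ennreal (s / t * A i t)" using s by (intro ennreal_mult'[symmetric]) simp
  finally have "A i s \<le> s / t * A i t"
    using s A_pos[OF i, of t] by (subst (asm) ennreal_le_iff) auto
  then show ?thesis using s by (simp add: field_simps)
qed

text \<open>The sign of the derivative, which makes the denominator of the rate of escape positive, follows from
the monotonicity of \<open>A i s / s\<close>.\<close>

lemma A_deriv:
  assumes i: "i \<in> I" and s: "0 < s" "s < 1"
  defines "D \<equiv> (Gr i s - (1 - s) * deriv (Gr i) s) / ((1 - s) * Gr i s)\<^sup>2"
  shows "(A i has_real_derivative D) (at s)" "0 < D"
proof -
  have g: "(1 - s) * Gr i s > 0" using Gr_bounds(1)[of i s] i s by auto
  show d: "(A i has_real_derivative D) (at s)"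
    unfolding A_def[abs_def] D_def using g s
    by (auto intro!: derivative_eq_intros Gr_deriv[OF i] simp: power2_eq_square field_simps)
  have "((\<lambda>s. A i s / s) has_real_derivative (D * s - A i s) / s\<^sup>2) (at s)"
    using d s by (auto intro!: derivative_eq_intros simp: power2_eq_square field_simps)
  have "0 \<le> (D * s - A i s) / s\<^sup>2"
  proof (rule ccontr)
    assume "\<not> 0 \<le> (D * s - A i s) / s\<^sup>2"
    with DERIV_neg_dec_right[OF \<open>((\<lambda>s. A i s / s) has_real_derivative (D * s - A i s) / s\<^sup>2) (at s)\<close>]
    obtain d where d: "0 < d" "\<And>h. 0 < h \<Longrightarrow> h < d \<Longrightarrow> A i (s + h) / (s + h) < A i s / s" by auto
    define h where "h = min (d / 2) ((1 - s) / 2)"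
    have "0 < h" "h < d" "s + h < 1" using d s by (auto simp: h_def min_def field_simps)
    then show False using d(2)[of h] A_ratio_mono[OF i s(1), of "s + h"] by auto
  qed
  then have "A i s \<le> D * s" using s by (simp add: zero_le_divide_iff)
  then show "0 < D" using A_pos[OF i s] s by (smt (verit) mult_nonpos_nonneg zero_less_mult_pos2)
qed

end

section \<open>First passage and Green functions of the free product\<close>

locale free_walk_at = free_walk +
  fixes z :: real
  assumes z_pos: "0 < z"
    and G_finite: "kgreen W (\<lambda>x y. ennreal (z * P x y)) [] [] < \<infinity>"
begin

abbreviation "q \<equiv> \<lambda>x y. ennreal (z * P x y)"
abbreviation "F \<equiv> hit W q []"
abbreviation "G \<equiv> kgreen W q [] []"

text \<open>The returns to the empty word whose first step goes into the factor \<open>i\<close>. Consequently \<open>H i\<close> below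
collects the returns that start in another factor, and \<open>\<xi> i\<close> is the weight of one step of the trace
of the walk on a copy of \<open>V i\<close>, the returning excursions into other copies included.\<close>

definition u :: "nat \<Rightarrow> ennreal" where
  "u i = (\<integral>\<^sup>+w. ennreal (z * \<alpha> i * p i (rt i) w) * F (app (rt i) [] w) \<partial>count_space (V i))"

lemma base_pos_Nil [simp]: "base i [] = []" "pos i [] = rt i"
  by (simp_all add: base_def pos_def)

lemma G_renewal: "G = 1 + (\<Sum>i\<in>I. u i) * G"
  using kgreen_return_hit[OF Nil_in_W G_finite] z_pos unfolding u_def
  by (subst (asm) row_operator) auto

lemma u_sum: "(\<Sum>i\<in>I. u i) < 1"
proof -
  define U where "U = (\<Sum>i\<in>I. u i)"
  have G1: "1 \<le> G" by (subst G_renewal) simp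
  obtain g where g: "G = ennreal g" "0 \<le> g" using G_finite by (cases G) auto
  have g1: "1 \<le> g" using G1 g by simp
  have "U * G \<le> G" by (subst (2) G_renewal) (simp add: U_def)
  then have "U \<noteq> \<infinity>" using g g1 by (auto simp: ennreal_top_mult top_unique)
  then obtain s where s: "U = ennreal s" "0 \<le> s" by (cases U) auto
  have "ennreal g = ennreal (1 + s * g)"
    using G_renewal[folded U_def] g s by (simp add: ennreal_mult'')
  then have gs: "g = 1 + s * g" using g s by (subst (asm) ennreal_inj) auto
  then have "s < 1" using g1 by (smt (verit) mult_right_mono mult_cancel_right1)
  then show ?thesis using s unfolding U_def[symmetric] by (simp add: ennreal_less_one_iff)
qed

definition ur :: "nat \<Rightarrow> real" where "ur i = enn2real (u i)"

lemma u_ur: "i \<in> I \<Longrightarrow> u i = ennreal (ur i)"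
proof -
  assume i: "i \<in> I"
  have "u i \<le> (\<Sum>i\<in>I. u i)" using i by (intro member_le_sum) auto
  also have "\<dots> < 1" by (rule u_sum)
  finally show ?thesis unfolding ur_def by (intro ennreal_enn2real[symmetric]) (auto simp: less_top[symmetric] top_unique)
qed

lemma ur_nonneg: "0 \<le> ur i" by (simp add: ur_def)

lemma u_sum_real: "(\<Sum>i\<in>J. u i) = ennreal (\<Sum>i\<in>J. ur i)" if "J \<subseteq> I"
proof -
  have "(\<Sum>i\<in>J. u i) = (\<Sum>i\<in>J. ennreal (ur i))" using that by (intro sum.cong u_ur) auto
  then show ?thesis by (simp add: ur_nonneg)
qed

lemma ur_sum_less: "(\<Sum>i\<in>I. ur i) < 1"
  using u_sum u_sum_real[of I] by (simp add: sum_nonneg ur_nonneg ennreal_less_one_iff)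

definition H :: "nat \<Rightarrow> real" where "H i = (\<Sum>j\<in>I - {i}. ur j)"

definition \<xi> :: "nat \<Rightarrow> real" where "\<xi> i = \<alpha> i * z / (1 - H i)"

lemma H_eq: "i \<in> I \<Longrightarrow> H i = (\<Sum>j\<in>I. ur j) - ur i"
  unfolding H_def by (simp add: sum_diff1)

lemma H_bounds: "0 \<le> H i" "i \<in> I \<Longrightarrow> H i < 1"
proof -
  show "0 \<le> H i" by (simp add: H_def sum_nonneg ur_nonneg)
  show "i \<in> I \<Longrightarrow> H i < 1" using H_eq[of i] ur_sum_less ur_nonneg[of i] by linarith
qed

lemma \<xi>_pos: "i \<in> I \<Longrightarrow> 0 < \<xi> i"
  using H_bounds \<alpha>_pos[of i] z_pos unfolding \<xi>_def by auto

lemma z\<alpha>: "i \<in> I \<Longrightarrow> z * \<alpha> i * x = (1 - H i) * (\<xi> i * x)"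
  using H_bounds(2)[of i] unfolding \<xi>_def by (simp add: field_simps)

lemma z\<alpha>_ennreal: "i \<in> I \<Longrightarrow> ennreal (z * \<alpha> i * x) * y = ennreal (1 - H i) * (ennreal (\<xi> i * x) * y)"
  using arg_cong[OF z\<alpha>[of i x], of ennreal] H_bounds(2)[of i] by (simp add: ennreal_mult' mult.assoc)

abbreviation "qf i \<equiv> \<lambda>v w. ennreal (\<xi> i * p i v w)"
abbreviation "Ff i \<equiv> hit (V i) (qf i) (rt i)"

definition Uf :: "nat \<Rightarrow> ennreal" where
  "Uf i = (\<integral>\<^sup>+w. qf i (rt i) w * Ff i w \<partial>count_space (V i))"

text \<open>On its way to the empty word, a path from \<open>v # x\<close> passes through \<open>[v]\<close>, and until then it
is a path from \<open>x\<close> to the empty word with \<open>v\<close> put in front of every word.\<close>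

lemma hit_cone_partial:
  assumes j: "j \<in> I" and v: "v \<in> V j - {rt j}"
  shows "x \<in> W \<Longrightarrow> x = [] \<or> hd x \<notin> V j \<Longrightarrow> (\<Sum>n<N. fpass W q [] n x) * F [v] \<le> F (v # x)"
proof (induction N arbitrary: x)
  case (Suc N)
  show ?case
  proof (cases "x = []")
    case True
    have "(\<Sum>n<Suc N. fpass W q [] n []) * F [v] \<le> 1 * F [v]"
      by (intro mult_right_mono sum_fpass_start) simp
    then show ?thesis using True by simp
  next
    case False
    have vx: "v # x \<in> W" using Suc.prems j v by (auto simp: Cons_in_W_iff)
    have bv: "base i (v # x) = v # base i x" "pos i (v # x) = pos i x" for i
      using False by (auto simp: base_def pos_def)
    have "(\<Sum>n<Suc N. fpass W q [] n x) * F [v] =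
        (\<Sum>i\<in>I. \<integral>\<^sup>+w. ennreal (z * \<alpha> i * p i (pos i x) w) *
          ((\<Sum>n<N. fpass W q [] n (app (rt i) (base i x) w)) * F [v]) \<partial>count_space (V i))"
      unfolding sum_fpass_Suc[OF False] using z_pos Suc.prems(1)
      by (simp add: row_operator sum_distrib_right nn_integral_multc[symmetric] mult.assoc)
    also have "\<dots> \<le> (\<Sum>i\<in>I. \<integral>\<^sup>+w. ennreal (z * \<alpha> i * p i (pos i x) w) *
          F (v # app (rt i) (base i x) w) \<partial>count_space (V i))"
    proof (intro sum_mono nn_integral_mono mult_left_mono Suc.IH)
      fix i w assume i: "i \<in> I" and "w \<in> space (count_space (V i))"
      then have w: "w \<in> V i" by simp
      show "app (rt i) (base i x) w \<in> W"
        using base_pos(1,2)[OF Suc.prems(1) i] i w by (rule app_in_W)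
      show "app (rt i) (base i x) w = [] \<or> hd (app (rt i) (base i x) w) \<notin> V j"
      proof (cases "base i x = []")
        case True
        with False have "butlast x = []" and lx: "last x \<in> V i" by (auto simp: base_def split: if_splits)
        then have "x = [last x]" using False by (metis append_butlast_last_id append_Nil)
        with Suc.prems(2) False lx have "i \<noteq> j" by (metis list.sel(1))
        then show ?thesis using True w factor_unique[OF i j w] by (auto simp: app_def)
      next
        case False2: False
        then have "hd (app (rt i) (base i x) w) = hd (base i x)" by (simp add: app_def)
        also have "\<dots> = hd x"
          using False2 False by (cases x) (auto simp: base_def split: if_splits)
        finally show ?thesis using Suc.prems(2) False by simp
      qed
    qed auto
    also have "\<dots> = F (v # x)"
      using vx z_pos by (subst hit_step, simp, subst row_operator) (auto simp: bv app_def intro!: sum.cong nn_integral_cong)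
    finally show ?thesis .
  qed
qed simp

lemma hit_cone:
  assumes "j \<in> I" "v \<in> V j - {rt j}" "x \<in> W" "x = [] \<or> hd x \<notin> V j"
  shows "F x * F [v] \<le> F (v # x)"
proof -
  have "F x * F [v] = (\<Sum>n. fpass W q [] n x * F [v])"
    unfolding hit_def[of W q "[]" x] by simp
  also have "\<dots> \<le> F (v # x)"
    by (rule suminf_le_bound) (use hit_cone_partial[OF assms(1,2,3,4)] in \<open>simp add: sum_distrib_right\<close>)
  finally show ?thesis .
qed

text \<open>At the word \<open>[v]\<close> the walk either moves within \<open>V j\<close> or makes an excursion from which it returns to
\<open>[v]\<close> with total weight \<open>H j\<close>. Solving for \<open>F [v]\<close> divides by \<open>1 - H j\<close> and turns the weight
\<open>z * \<alpha> j\<close> of a step into \<open>\<xi> j\<close>.\<close>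

lemma hit_letter_step:
  assumes j: "j \<in> I" and v: "v \<in> V j" "v \<noteq> rt j"
  shows "(\<integral>\<^sup>+w. qf j v w * F (app (rt j) [] w) \<partial>count_space (V j)) \<le> F [v]"
proof (cases "F [v] = \<infinity>")
  case False
  let ?X = "\<lambda>w. F (app (rt j) [] w)"
  have vW: "[v] \<in> W" using app_in_W[of "[]" j v] j v by (simp add: app_def)
  let ?T = "\<lambda>i. \<integral>\<^sup>+w. ennreal (z * \<alpha> i * p i (pos i [v]) w) * F (app (rt i) (base i [v]) w) \<partial>count_space (V i)"
  have step: "F [v] = (\<Sum>i\<in>I. ?T i)"
    by (subst hit_step, simp) (rule row_operator[OF vW less_imp_le[OF z_pos]])
  have "?T j = ennreal (1 - H j) * (\<integral>\<^sup>+w. qf j v w * ?X w \<partial>count_space (V j))"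
    using v by (subst nn_integral_cmult[symmetric])
      (auto simp: base_def pos_def z\<alpha>_ennreal[OF j])
  moreover have "u i * F [v] \<le> ?T i" if i: "i \<in> I - {j}" for i
  proof -
    have nv: "v \<notin> V i" using i j v factor_unique[of i j v] by blast
    have "u i * F [v] = (\<integral>\<^sup>+w. ennreal (z * \<alpha> i * p i (rt i) w) * (F (app (rt i) [] w) * F [v]) \<partial>count_space (V i))"
      unfolding u_def by (subst nn_integral_multc[symmetric]) (auto simp: mult.assoc)
    also have "\<dots> \<le> (\<integral>\<^sup>+w. ennreal (z * \<alpha> i * p i (rt i) w) * F (v # app (rt i) [] w) \<partial>count_space (V i))"
    proof (intro nn_integral_mono mult_left_mono hit_cone[OF j])
      fix w assume "w \<in> space (count_space (V i))"
      then have w: "w \<in> V i" by simp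
      show "app (rt i) [] w \<in> W" using app_in_W[of "[]" i w] i w by simp
      show "app (rt i) [] w = [] \<or> hd (app (rt i) [] w) \<notin> V j"
        using i j w factor_unique[of i j w] by (auto simp: app_def)
    qed (use v in auto)
    also have "\<dots> = ?T i" using nv by (auto simp: base_def pos_def app_def intro!: nn_integral_cong)
    finally show ?thesis .
  qed
  then have "(\<Sum>i\<in>I - {j}. u i) * F [v] \<le> (\<Sum>i\<in>I - {j}. ?T i)"
    unfolding sum_distrib_right by (intro sum_mono)
  moreover have "(\<Sum>i\<in>I. ?T i) = ?T j + (\<Sum>i\<in>I - {j}. ?T i)" using j by (intro sum.remove) auto
  ultimately have le: "ennreal (1 - H j) * (\<integral>\<^sup>+w. qf j v w * ?X w \<partial>count_space (V j)) + ennreal (H j) * F [v] \<le> F [v]"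
    using step u_sum_real[of "I - {j}"] by (simp add: H_def add_left_mono)
  obtain f where f: "F [v] = ennreal f" "0 \<le> f" using False by (cases "F [v]") auto
  let ?Y = "\<integral>\<^sup>+w. qf j v w * ?X w \<partial>count_space (V j)"
  \<comment> \<open>Both sides have to be finite before \<open>ennreal (H j) * F [v]\<close> can be subtracted.\<close>
  have "?Y \<noteq> \<infinity>"
  proof
    assume "?Y = \<infinity>"
    with le f H_bounds(2)[OF j] show False by (auto simp: ennreal_mult_top top_unique)
  qed
  then obtain y where y: "?Y = ennreal y" "0 \<le> y" by (cases ?Y) auto
  have "(1 - H j) * y + H j * f \<le> f"
    using le f y H_bounds(1)[of j] H_bounds(2)[OF j]
    by (simp add: ennreal_mult''[symmetric] ennreal_plus[symmetric] del: ennreal_plus)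
  then have "(1 - H j) * y \<le> (1 - H j) * f" by (simp add: algebra_simps)
  then show ?thesis using H_bounds(2)[OF j] f y by simp
qed simp

lemma factor_hit_le: "j \<in> I \<Longrightarrow> v \<in> V j \<Longrightarrow> Ff j v \<le> F (app (rt j) [] v)"
proof (rule hit_minimal)
  fix x assume "j \<in> I" "x \<in> V j" "x \<noteq> rt j"
  then show "(\<integral>\<^sup>+w. qf j x w * F (app (rt j) [] w) \<partial>count_space (V j)) \<le> F (app (rt j) [] x)"
    using hit_letter_step[of j x] by (simp add: app_def[of "rt j" "[]" x])
qed (simp_all add: app_def)

lemma Uf_le: "j \<in> I \<Longrightarrow> ennreal (1 - H j) * Uf j \<le> u j"
proof -
  assume j: "j \<in> I"
  have "ennreal (1 - H j) * Uf j = (\<integral>\<^sup>+w. ennreal (z * \<alpha> j * p j (rt j) w) * Ff j w \<partial>count_space (V j))"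
    unfolding Uf_def by (subst nn_integral_cmult[symmetric]) (auto simp: z\<alpha>_ennreal[OF j])
  also have "\<dots> \<le> u j"
    unfolding u_def by (intro nn_integral_mono mult_left_mono factor_hit_le[OF j]) auto
  finally show ?thesis .
qed

text \<open>The balance at a vertex: one step in its own copy or a returning excursion into another one.
It is what makes products over the letters of a word supersolutions.\<close>

lemma branch_sum_le: "i \<in> I \<Longrightarrow> ennreal (1 - H i) + (\<Sum>j\<in>I - {i}. ennreal (1 - H j) * Uf j) \<le> 1"
proof -
  assume i: "i \<in> I"
  have "(\<Sum>j\<in>I - {i}. ennreal (1 - H j) * Uf j) \<le> (\<Sum>j\<in>I - {i}. u j)" by (intro sum_mono Uf_le) auto
  also have "\<dots> = ennreal (H i)" using u_sum_real[of "I - {i}"] by (simp add: H_def)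
  finally have "ennreal (1 - H i) + (\<Sum>j\<in>I - {i}. ennreal (1 - H j) * Uf j) \<le> ennreal (1 - H i) + ennreal (H i)"
    by (rule add_left_mono)
  also have "\<dots> = 1" using H_bounds(1)[of i] H_bounds(2)[OF i] by (simp add: ennreal_plus[symmetric] del: ennreal_plus)
  finally show ?thesis .
qed

definition fac :: "'a \<Rightarrow> nat" where "fac v = (THE i. i \<in> I \<and> v \<in> V i)"

lemma fac_eq: "i \<in> I \<Longrightarrow> v \<in> V i \<Longrightarrow> fac v = i"
  unfolding fac_def by (rule the_equality) (auto intro: factor_unique)

definition wprod :: "(nat \<Rightarrow> 'a \<Rightarrow> ennreal) \<Rightarrow> 'a list \<Rightarrow> ennreal" where
  "wprod f x = prod_list (map (\<lambda>v. f (fac v) v) x)"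

lemma wprod_app: "i \<in> I \<Longrightarrow> w \<in> V i \<Longrightarrow> f i (rt i) = 1 \<Longrightarrow> wprod f (app (rt i) b w) = wprod f b * f i w"
  by (auto simp: wprod_def app_def fac_eq)

text \<open>The kernel \<open>a\<close> stands for \<open>p\<close> or for its transpose, so that the lemma serves for the first passage
function and for the Green function alike. The copy of \<open>V i\<close> that contains the last letter contributes
at most \<open>(1 - H i) * wprod f x\<close>, and each copy of another \<open>V j\<close> attached at \<open>x\<close> contributes
\<open>(1 - H j) * Uf j * wprod f x\<close>; then \<open>branch_sum_le\<close> applies.\<close>

lemma wprod_supersolution:
  assumes x: "x \<in> W" "x \<noteq> []" and rt1: "\<And>i. i \<in> I \<Longrightarrow> f i (rt i) = 1"
    and step: "\<And>i v. i \<in> I \<Longrightarrow> v \<in> V i \<Longrightarrow> v \<noteq> rt i \<Longrightarrow>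
      (\<integral>\<^sup>+w. ennreal (\<xi> i * a i v w) * f i w \<partial>count_space (V i)) \<le> f i v"
    and ret: "\<And>i. i \<in> I \<Longrightarrow> (\<integral>\<^sup>+w. ennreal (\<xi> i * a i (rt i) w) * f i w \<partial>count_space (V i)) = Uf i"
  shows "(\<Sum>i\<in>I. \<integral>\<^sup>+w. ennreal (z * \<alpha> i * a i (pos i x) w) * wprod f (app (rt i) (base i x) w) \<partial>count_space (V i))
    \<le> wprod f x"
proof -
  let ?T = "\<lambda>i. \<integral>\<^sup>+w. ennreal (z * \<alpha> i * a i (pos i x) w) * wprod f (app (rt i) (base i x) w) \<partial>count_space (V i)"
  have T: "?T i = ennreal (1 - H i) * (wprod f (base i x) *
      (\<integral>\<^sup>+w. ennreal (\<xi> i * a i (pos i x) w) * f i w \<partial>count_space (V i)))" if i: "i \<in> I" for i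
    unfolding mult.assoc[symmetric]
  proof (subst nn_integral_cmult[symmetric], simp, intro nn_integral_cong)
    fix w assume "w \<in> space (count_space (V i))"
    then have "ennreal (z * \<alpha> i * a i (pos i x) w) * wprod f (app (rt i) (base i x) w) =
        ennreal (1 - H i) * (ennreal (\<xi> i * a i (pos i x) w) * (wprod f (base i x) * f i w))"
      by (simp only: wprod_app[where f = f, OF i _ rt1[OF i]] space_count_space z\<alpha>_ennreal[OF i])
    then show "ennreal (z * \<alpha> i * a i (pos i x) w) * wprod f (app (rt i) (base i x) w) =
        ennreal (1 - H i) * wprod f (base i x) * (ennreal (\<xi> i * a i (pos i x) w) * f i w)"
      by (simp only: mult_ac)
  qed
  obtain b v where xb: "x = b @ [v]" using x(2) by (metis append_butlast_last_id)
  obtain i where i: "i \<in> I" "v \<in> V i" "v \<noteq> rt i" using x(1) xb by (auto simp: snoc_in_W_iff)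
  have bi: "base i x = b" "pos i x = v" using i xb by (auto simp: base_def pos_def)
  have fx: "wprod f x = wprod f b * f i v"
    using i by (auto simp: xb wprod_def fac_eq)
  have "?T i \<le> ennreal (1 - H i) * wprod f x"
    unfolding T[OF i(1)] unfolding bi fx by (intro mult_left_mono step i) auto
  moreover have "?T j = ennreal (1 - H j) * Uf j * wprod f x" if j: "j \<in> I - {i}" for j
  proof -
    have "v \<notin> V j" using i j factor_unique[of i j v] by blast
    then have "base j x = x" "pos j x = rt j" by (auto simp: base_def pos_def xb)
    then show ?thesis using j T[of j] ret[of j] by (simp add: mult_ac)
  qed
  ultimately have "?T i + (\<Sum>j\<in>I - {i}. ?T j) \<le>
      ennreal (1 - H i) * wprod f x + (\<Sum>j\<in>I - {i}. ennreal (1 - H j) * Uf j * wprod f x)"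
    by (intro add_mono sum_mono) auto
  also have "\<dots> = (ennreal (1 - H i) + (\<Sum>j\<in>I - {i}. ennreal (1 - H j) * Uf j)) * wprod f x"
    by (simp add: distrib_right sum_distrib_right)
  also have "\<dots> \<le> 1 * wprod f x" by (intro mult_right_mono branch_sum_le i) auto
  finally show ?thesis using i by (subst sum.remove[of _ i]) auto
qed

lemma hit_le_wprod: "x \<in> W \<Longrightarrow> F x \<le> wprod Ff x"
proof (rule hit_minimal)
  fix x assume x: "x \<in> W" "x \<noteq> []"
  show "(\<integral>\<^sup>+w. q x w * wprod Ff w \<partial>count_space W) \<le> wprod Ff x"
    unfolding row_operator[OF x(1) less_imp_le[OF z_pos]]
    by (rule wprod_supersolution[where a = p, OF x]) (auto simp: hit_step Uf_def)
qed (auto simp: wprod_def)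

text \<open>The lower bound \<open>Uf_le\<close> provided the supersolution \<open>wprod Ff\<close>, which now yields the upper bound.\<close>

lemma u_eq: "i \<in> I \<Longrightarrow> u i = ennreal (1 - H i) * Uf i"
proof (rule antisym[OF _ Uf_le])
  assume i: "i \<in> I"
  have "u i \<le> (\<integral>\<^sup>+w. ennreal (z * \<alpha> i * p i (rt i) w) * Ff i w \<partial>count_space (V i))"
    unfolding u_def
  proof (intro nn_integral_mono mult_left_mono)
    fix w assume "w \<in> space (count_space (V i))"
    then have w: "w \<in> V i" by simp
    have "F (app (rt i) [] w) \<le> wprod Ff (app (rt i) [] w)"
      using i w by (intro hit_le_wprod app_in_W) auto
    also have "\<dots> = Ff i w" using i w by (subst wprod_app) (auto simp: wprod_def)
    finally show "F (app (rt i) [] w) \<le> Ff i w" .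
  qed auto
  also have "\<dots> = ennreal (1 - H i) * Uf i"
    unfolding Uf_def by (subst nn_integral_cmult[symmetric]) (auto simp: z\<alpha>_ennreal[OF i])
  finally show "u i \<le> ennreal (1 - H i) * Uf i" .
qed auto

text \<open>The product over the letters is the weight of the paths split at their last visits to the
  prefixes of \<open>y\<close>.\<close>

lemma kgreen_le_wprod:
  assumes \<xi>: "\<And>i. i \<in> I \<Longrightarrow> \<xi> i < 1" and y: "y \<in> W"
  shows "kgreen W q [] y \<le> G * wprod (\<lambda>i. L i (\<xi> i)) y"
proof (rule kgreen_le_supersolution_right[OF W_countable Nil_in_W _ _ y])
  fix x assume x: "x \<in> W" "x \<noteq> []"
  have "(\<integral>\<^sup>+w. wprod (\<lambda>i. L i (\<xi> i)) w * q w x \<partial>count_space W) =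
     (\<Sum>i\<in>I. \<integral>\<^sup>+w. ennreal (z * \<alpha> i * p i w (pos i x)) *
       wprod (\<lambda>i. L i (\<xi> i)) (app (rt i) (base i x) w) \<partial>count_space (V i))"
    using z_pos x by (subst col_operator) (auto simp: mult.commute)
  also have "\<dots> \<le> wprod (\<lambda>i. L i (\<xi> i)) x"
  proof (rule wprod_supersolution[where a = "\<lambda>i v w. p i w v", OF x])
    fix i assume i: "i \<in> I"
    note \<xi>i = less_imp_le[OF \<xi>_pos[OF i]] \<xi>[OF i]
    show "L i (\<xi> i) (rt i) = 1" by (rule L_root[OF i \<xi>i])
    show "(\<integral>\<^sup>+w. qf i w (rt i) * L i (\<xi> i) w \<partial>count_space (V i)) = Uf i"
      unfolding Uf_def by (rule L_return[OF i \<xi>i])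
    show "(\<integral>\<^sup>+w. qf i w v * L i (\<xi> i) w \<partial>count_space (V i)) \<le> L i (\<xi> i) v"
      if "v \<in> V i" "v \<noteq> rt i" for v using L_step[OF i that] by simp
  qed
  finally show "(\<integral>\<^sup>+w. wprod (\<lambda>i. L i (\<xi> i)) w * q w x \<partial>count_space W) \<le> wprod (\<lambda>i. L i (\<xi> i)) x" .
qed (simp add: wprod_def)

end

section \<open>Exponential moments of the block length\<close>

lemma nn_integral_count_space_Times:
  assumes "countable A" "countable B"
  shows "(\<integral>\<^sup>+x. f x \<partial>count_space (A \<times> B)) = (\<integral>\<^sup>+a. \<integral>\<^sup>+b. f (a, b) \<partial>count_space B \<partial>count_space A)"
proof -
  interpret sigma_finite_measure "count_space B"
    by (rule sigma_finite_measure_count_space_countable) fact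
  show ?thesis
    unfolding pair_measure_countable[OF assms, symmetric]
    by (rule nn_integral_fst[symmetric]) (simp add: pair_measure_countable[OF assms])
qed

context free_walk_at
begin

abbreviation "Lw \<equiv> wprod (\<lambda>i. L i (\<xi> i))"

definition words_from :: "nat \<Rightarrow> nat \<Rightarrow> 'a list set" where
  "words_from k j = {y \<in> W. length y = Suc k \<and> hd y \<in> V j}"

definition words_avoiding :: "nat \<Rightarrow> nat \<Rightarrow> 'a list set" where
  "words_avoiding k j = {y \<in> W. length y = k \<and> (y = [] \<or> hd y \<notin> V j)}"

lemma hd_in_factor: "y \<in> W \<Longrightarrow> y \<noteq> [] \<Longrightarrow> \<exists>i\<in>I. hd y \<in> V i"
  by (cases y) (auto simp: Cons_in_W_iff)

lemma words_from_eq: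
  assumes j: "j \<in> I"
  shows "words_from k j = (\<lambda>(v, y). v # y) ` ((V j - {rt j}) \<times> words_avoiding k j)"
proof (intro set_eqI iffI)
  fix y assume "y \<in> words_from k j"
  then obtain v x where y: "y = v # x" "y \<in> W" "length x = k" "v \<in> V j" unfolding words_from_def by (cases y) auto
  then obtain i where i: "i \<in> I" "v \<in> V i - {rt i}" "x = [] \<or> hd x \<notin> V i" "x \<in> W" by (auto simp: Cons_in_W_iff)
  then have "i = j" using factor_unique[of i j v] y j by blast
  then show "y \<in> (\<lambda>(v, y). v # y) ` ((V j - {rt j}) \<times> words_avoiding k j)"
    using i y by (auto simp: words_avoiding_def)
next
  fix y assume "y \<in> (\<lambda>(v, y). v # y) ` ((V j - {rt j}) \<times> words_avoiding k j)"
  then show "y \<in> words_from k j"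
    using j unfolding words_from_def words_avoiding_def by (fastforce simp: Cons_in_W_iff)
qed

text \<open>Removing the first letter \<open>v\<close> of a word removes the factor \<open>L j (\<xi> j) v\<close> from its weight, and \<open>v\<close> is
independent of the rest apart from the choice of \<open>j\<close>.\<close>

lemma weight_words_from:
  assumes j: "j \<in> I" and \<xi>1: "\<xi> j < 1"
  shows "(\<integral>\<^sup>+y. Lw y \<partial>count_space (words_from k j)) =
    ennreal (A j (\<xi> j)) * (\<integral>\<^sup>+y. Lw y \<partial>count_space (words_avoiding k j))"
proof -
  have cX: "countable (words_avoiding k j)"
    by (rule countable_subset[OF _ W_countable]) (auto simp: words_avoiding_def)
  have cV: "countable (V j - {rt j})" using V_countable[OF j] by simp
  have "(\<integral>\<^sup>+y. Lw y \<partial>count_space (words_from k j)) =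
      (\<integral>\<^sup>+x. Lw (case x of (v, y) \<Rightarrow> v # y) \<partial>count_space ((V j - {rt j}) \<times> words_avoiding k j))"
    unfolding words_from_eq[OF j]
    by (rule nn_integral_bij_count_space[symmetric]) (auto simp: bij_betw_def inj_on_def)
  also have "\<dots> = (\<integral>\<^sup>+v. \<integral>\<^sup>+y. L j (\<xi> j) v * Lw y \<partial>count_space (words_avoiding k j) \<partial>count_space (V j - {rt j}))"
    unfolding nn_integral_count_space_Times[OF cV cX]
    by (intro nn_integral_cong) (auto simp: wprod_def fac_eq[OF j])
  also have "\<dots> = (\<integral>\<^sup>+v. L j (\<xi> j) v \<partial>count_space (V j - {rt j})) * (\<integral>\<^sup>+y. Lw y \<partial>count_space (words_avoiding k j))"
    by (simp add: nn_integral_cmult nn_integral_multc)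
  finally show ?thesis using L_sum[OF j \<xi>_pos[OF j] \<xi>1] by simp
qed

lemma weight_words_avoiding_0: "(\<integral>\<^sup>+y. Lw y \<partial>count_space (words_avoiding 0 j)) = 1"
proof -
  have "words_avoiding 0 j = {[]}" by (auto simp: words_avoiding_def)
  then show ?thesis by (simp add: nn_integral_count_space_finite wprod_def)
qed

lemma weight_by_first_letter:
  assumes "J \<subseteq> I" and E: "\<And>y. y \<in> E \<longleftrightarrow> y \<in> W \<and> length y = Suc k \<and> (\<exists>i\<in>J. hd y \<in> V i)"
  shows "(\<integral>\<^sup>+y. f y \<partial>count_space E) = (\<Sum>i\<in>J. \<integral>\<^sup>+y. f y \<partial>count_space (words_from k i))"
proof -
  have fin: "finite J" using assms(1) finite_subset by blast
  have "(\<integral>\<^sup>+y. f y \<partial>count_space E) = (\<integral>\<^sup>+y. (\<Sum>i\<in>J. f y * indicator (words_from k i) y) \<partial>count_space UNIV)"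
  proof (subst nn_integral_count_space_indicator, simp, intro nn_integral_cong)
    fix y
    show "f y * indicator E y = (\<Sum>i\<in>J. f y * indicator (words_from k i) y)"
    proof (cases "y \<in> E")
      case True
      then obtain i where i: "i \<in> J" "hd y \<in> V i" "y \<in> W" "length y = Suc k" using E by blast
      have "(\<Sum>i\<in>J. f y * indicator (words_from k i) y) = (\<Sum>l\<in>{i}. f y * indicator (words_from k l) y)"
      proof (rule sum.mono_neutral_right[OF fin])
        have "\<forall>l\<in>J - {i}. hd y \<notin> V l"
          using i assms(1) factor_unique by blast
        then show "\<forall>l\<in>J - {i}. f y * indicator (words_from k l) y = 0"
          by (auto simp: words_from_def)
      qed (use i in auto)
      then show ?thesis using i True by (simp add: words_from_def)
    next
      case False
      then have "y \<notin> words_from k i" if "i \<in> J" for i using that E by (auto simp: words_from_def)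
      then show ?thesis using False by simp
    qed
  qed
  also have "\<dots> = (\<Sum>i\<in>J. \<integral>\<^sup>+y. f y * indicator (words_from k i) y \<partial>count_space UNIV)"
    by (rule nn_integral_sum) simp
  also have "\<dots> = (\<Sum>i\<in>J. \<integral>\<^sup>+y. f y \<partial>count_space (words_from k i))"
    by (intro sum.cong refl) (subst (2) nn_integral_count_space_indicator, auto)
  finally show ?thesis .
qed

lemma weight_words_avoiding_Suc:
  assumes j: "j \<in> I"
  shows "(\<integral>\<^sup>+y. Lw y \<partial>count_space (words_avoiding (Suc k) j)) =
    (\<Sum>i\<in>I - {j}. \<integral>\<^sup>+y. Lw y \<partial>count_space (words_from k i))"
proof (rule weight_by_first_letter)
  fix y
  have "y \<in> W \<Longrightarrow> y \<noteq> [] \<Longrightarrow> hd y \<notin> V j \<longleftrightarrow> (\<exists>i\<in>I - {j}. hd y \<in> V i)"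
    using hd_in_factor[of y] factor_unique[OF j] by blast
  then show "y \<in> words_avoiding (Suc k) j \<longleftrightarrow> y \<in> W \<and> length y = Suc k \<and> (\<exists>i\<in>I - {j}. hd y \<in> V i)"
    unfolding words_avoiding_def by (cases "y = []") auto
qed auto

text \<open>The transfer matrix that maps the weights for length \<open>k\<close> to those for length \<open>k + 1\<close> has the
  entries \<open>A j\<close> off the diagonal. The vector \<open>A j / (\<rho> + A j)\<close> is an eigenvector with eigenvalue
  \<open>\<rho>\<close> if its entries sum up to \<open>1\<close>, and satisfies the inequality needed here if they sum up to less.\<close>

lemma weight_words_from_le:
  assumes \<xi>1: "\<And>i. i \<in> I \<Longrightarrow> \<xi> i < 1" and \<rho>: "0 < \<rho>"
    and sum1: "(\<Sum>i\<in>I. A i (\<xi> i) / (\<rho> + A i (\<xi> i))) \<le> 1"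
  defines "C \<equiv> \<rho> + (\<Sum>i\<in>I. A i (\<xi> i))"
  shows "j \<in> I \<Longrightarrow> (\<integral>\<^sup>+y. Lw y \<partial>count_space (words_from k j)) \<le>
    ennreal (C * \<rho> ^ k * (A j (\<xi> j) / (\<rho> + A j (\<xi> j))))"
proof (induction k arbitrary: j)
  case (0 j)
  define a where "a i = A i (\<xi> i)" for i
  have a: "0 < a i" if "i \<in> I" for i using A_pos[OF that \<xi>_pos[OF that] \<xi>1[OF that]] by (simp add: a_def)
  have "a j \<le> sum a I" using 0 a by (intro member_le_sum) (auto intro: less_imp_le)
  then have "\<rho> + a j \<le> C" unfolding C_def a_def[symmetric] by simp
  then have "a j * (\<rho> + a j) \<le> a j * C" using a[OF 0] by (intro mult_left_mono) auto
  then have "a j \<le> C * (a j / (\<rho> + a j))" using a[OF 0] \<rho> by (simp add: field_simps)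
  then show ?case
    unfolding weight_words_from[OF 0 \<xi>1[OF 0]] weight_words_avoiding_0 using 0 by (simp add: a_def ennreal_leI)
next
  case (Suc k j)
  define a where "a i = A i (\<xi> i)" for i
  have a: "0 < a i" if "i \<in> I" for i using A_pos[OF that \<xi>_pos[OF that] \<xi>1[OF that]] by (simp add: a_def)
  have C: "0 < C" unfolding C_def a_def[symmetric] using \<rho> a by (intro add_pos_nonneg sum_nonneg) (auto intro: less_imp_le)
  have j: "j \<in> I" by fact
  have "(\<integral>\<^sup>+y. Lw y \<partial>count_space (words_from (Suc k) j)) \<le>
      ennreal (a j) * (\<Sum>i\<in>I - {j}. ennreal (C * \<rho> ^ k * (a i / (\<rho> + a i))))"
    unfolding weight_words_from[OF j \<xi>1[OF j]] weight_words_avoiding_Suc[OF j] a_def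
    by (intro mult_left_mono sum_mono Suc.IH) auto
  also have "(\<Sum>i\<in>I - {j}. ennreal (C * \<rho> ^ k * (a i / (\<rho> + a i)))) =
      ennreal (\<Sum>i\<in>I - {j}. C * \<rho> ^ k * (a i / (\<rho> + a i)))"
  proof (rule sum_ennreal)
    fix i assume "i \<in> I - {j}"
    then have "0 < a i" by (intro a) simp
    with C \<rho> show "0 \<le> C * \<rho> ^ k * (a i / (\<rho> + a i))" by simp
  qed
  also have "(\<Sum>i\<in>I - {j}. C * \<rho> ^ k * (a i / (\<rho> + a i))) = C * \<rho> ^ k * ((\<Sum>i\<in>I. a i / (\<rho> + a i)) - a j / (\<rho> + a j))"
    unfolding sum_distrib_left[symmetric] using j by (simp only: sum_diff1 finite_atLeastAtMost if_True)
  also have "ennreal (a j) * ennreal \<dots> = ennreal (a j * (C * \<rho> ^ k * ((\<Sum>i\<in>I. a i / (\<rho> + a i)) - a j / (\<rho> + a j))))"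
    using a[OF j] by (intro ennreal_mult'[symmetric]) simp
  also have "\<dots> \<le> ennreal (a j * (C * \<rho> ^ k * (1 - a j / (\<rho> + a j))))"
    using a[OF j] C \<rho> sum1 unfolding a_def[symmetric]
    by (intro ennreal_leI mult_left_mono diff_right_mono) auto
  also have "a j * (C * \<rho> ^ k * (1 - a j / (\<rho> + a j))) = C * \<rho> ^ Suc k * (a j / (\<rho> + a j))"
    using a[OF j] \<rho> by (simp add: field_simps)
  finally show ?case by (simp only: a_def)
qed

text \<open>Words of length \<open>k\<close> have total weight at most a constant times \<open>\<rho> ^ k\<close>, which \<open>\<theta> ^ k\<close> turns
into a convergent geometric series; the Green function dominates each single power of the kernel.\<close>

lemma exponential_moment:
  assumes \<xi>1: "\<And>i. i \<in> I \<Longrightarrow> \<xi> i < 1" and \<rho>: "0 < \<rho>"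
    and sum1: "(\<Sum>i\<in>I. A i (\<xi> i) / (\<rho> + A i (\<xi> i))) \<le> 1"
    and \<theta>: "0 < \<theta>" "\<theta> * \<rho> < 1"
  shows "\<exists>K\<ge>0. \<forall>n. (\<integral>\<^sup>+y. ennreal (\<theta> ^ length y) * kpow W q n [] y \<partial>count_space W) \<le> ennreal K"
proof -
  define C where "C = \<rho> + (\<Sum>i\<in>I. A i (\<xi> i))"
  define t where "t k = (\<integral>\<^sup>+y. ennreal (\<theta> ^ k) * Lw y * indicator {y. length y = k} y \<partial>count_space W)" for k
  have a: "0 < A i (\<xi> i)" if "i \<in> I" for i using A_pos[OF that \<xi>_pos[OF that] \<xi>1[OF that]] .
  have C: "0 < C" unfolding C_def using \<rho> a by (intro add_pos_nonneg sum_nonneg) (auto intro: less_imp_le)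
  have t0: "t 0 = 1"
  proof -
    have "t 0 = (\<integral>\<^sup>+y. Lw y * indicator {[]} y \<partial>count_space W)"
      unfolding t_def by (intro nn_integral_cong) (auto split: split_indicator)
    then show ?thesis by (simp add: wprod_def)
  qed
  have tS: "t (Suc k) \<le> ennreal (C * \<theta> * (\<theta> * \<rho>) ^ k)" for k
  proof -
    have "(\<integral>\<^sup>+y. Lw y \<partial>count_space {y \<in> W. length y = Suc k}) = (\<Sum>i\<in>I. \<integral>\<^sup>+y. Lw y \<partial>count_space (words_from k i))"
    proof (rule weight_by_first_letter)
      show "y \<in> {y \<in> W. length y = Suc k} \<longleftrightarrow> y \<in> W \<and> length y = Suc k \<and> (\<exists>i\<in>I. hd y \<in> V i)" for y
        using hd_in_factor[of y] by (cases y) auto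
    qed simp
    also have "\<dots> \<le> (\<Sum>i\<in>I. ennreal (C * \<rho> ^ k * (A i (\<xi> i) / (\<rho> + A i (\<xi> i)))))"
      unfolding C_def by (intro sum_mono weight_words_from_le[OF \<xi>1 \<rho> sum1])
    also have "\<dots> = ennreal (\<Sum>i\<in>I. C * \<rho> ^ k * (A i (\<xi> i) / (\<rho> + A i (\<xi> i))))"
    proof (rule sum_ennreal)
      fix i assume "i \<in> I"
      from a[OF this] C \<rho> show "0 \<le> C * \<rho> ^ k * (A i (\<xi> i) / (\<rho> + A i (\<xi> i)))" by simp
    qed
    also have "\<dots> \<le> ennreal (C * \<rho> ^ k * 1)"
      unfolding sum_distrib_left[symmetric] using C \<rho> by (intro ennreal_leI mult_left_mono sum1) auto
    finally have le: "(\<integral>\<^sup>+y. Lw y \<partial>count_space {y \<in> W. length y = Suc k}) \<le> ennreal (C * \<rho> ^ k * 1)" .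
    have "t (Suc k) = ennreal (\<theta> ^ Suc k) * (\<integral>\<^sup>+y. Lw y \<partial>count_space {y \<in> W. length y = Suc k})"
      unfolding t_def by (subst nn_integral_cmult[symmetric])
        (auto simp: nn_integral_count_space_indicator intro!: nn_integral_cong split: split_indicator)
    also have "\<dots> \<le> ennreal (\<theta> ^ Suc k) * ennreal (C * \<rho> ^ k * 1)"
      by (intro mult_left_mono le) simp
    also have "\<dots> = ennreal (C * \<theta> * (\<theta> * \<rho>) ^ k)"
      using \<theta> by (subst ennreal_mult'[symmetric]) (auto simp: power_mult_distrib mult_ac)
    finally show ?thesis .
  qed
  have "(\<integral>\<^sup>+y. ennreal (\<theta> ^ length y) * Lw y \<partial>count_space W) = (\<Sum>k. t k)"
  proof -
    have "(\<integral>\<^sup>+y. ennreal (\<theta> ^ length y) * Lw y \<partial>count_space W) =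
        (\<integral>\<^sup>+y. (\<Sum>k. ennreal (\<theta> ^ k) * Lw y * indicator {y. length y = k} y) \<partial>count_space W)"
    proof (intro nn_integral_cong)
      fix y :: "'a list"
      have "(\<Sum>k. ennreal (\<theta> ^ k) * Lw y * indicator {y. length y = k} y) =
          (\<Sum>k\<in>{length y}. ennreal (\<theta> ^ k) * Lw y * indicator {y. length y = k} y)"
        by (rule suminf_finite) auto
      then show "ennreal (\<theta> ^ length y) * Lw y = (\<Sum>k. ennreal (\<theta> ^ k) * Lw y * indicator {y. length y = k} y)"
        by simp
    qed
    also have "\<dots> = (\<Sum>k. t k)" unfolding t_def by (rule nn_integral_suminf) simp
    finally show ?thesis .
  qed
  also have "\<dots> = 1 + (\<Sum>k. t (Suc k))" by (subst suminf_split_first) (simp add: t0)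
  also have "\<dots> \<le> 1 + (\<Sum>k. ennreal (C * \<theta> * (\<theta> * \<rho>) ^ k))"
    by (intro add_left_mono suminf_le tS) auto
  also have "(\<Sum>k. ennreal (C * \<theta> * (\<theta> * \<rho>) ^ k)) = ennreal (\<Sum>k. C * \<theta> * (\<theta> * \<rho>) ^ k)"
    using C \<theta> \<rho> by (intro suminf_ennreal2 summable_mult summable_geometric) auto
  finally have fin: "(\<integral>\<^sup>+y. ennreal (\<theta> ^ length y) * Lw y \<partial>count_space W) < \<infinity>"
    by (rule order.strict_trans1) simp
  define K where "K = enn2real (G * (\<integral>\<^sup>+y. ennreal (\<theta> ^ length y) * Lw y \<partial>count_space W))"
  have K: "G * (\<integral>\<^sup>+y. ennreal (\<theta> ^ length y) * Lw y \<partial>count_space W) = ennreal K"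
    unfolding K_def using fin G_finite by (intro ennreal_enn2real[symmetric]) (auto simp: ennreal_mult_less_top)
  have "(\<integral>\<^sup>+y. ennreal (\<theta> ^ length y) * kpow W q n [] y \<partial>count_space W) \<le> ennreal K" for n
  proof -
    have "(\<integral>\<^sup>+y. ennreal (\<theta> ^ length y) * kpow W q n [] y \<partial>count_space W) \<le>
        (\<integral>\<^sup>+y. G * (ennreal (\<theta> ^ length y) * Lw y) \<partial>count_space W)"
    proof (intro nn_integral_mono)
      fix y assume "y \<in> space (count_space W)"
      then have y: "y \<in> W" by simp
      have "kpow W q n [] y \<le> kgreen W q [] y"
        unfolding kgreen_def using sum_le_suminf[OF summableI, of "{n}" "\<lambda>n. kpow W q n [] y"] by simp
      also have "\<dots> \<le> G * Lw y" by (rule kgreen_le_wprod[OF \<xi>1 y])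
      finally have "ennreal (\<theta> ^ length y) * kpow W q n [] y \<le> ennreal (\<theta> ^ length y) * (G * Lw y)"
        by (intro mult_left_mono) auto
      then show "ennreal (\<theta> ^ length y) * kpow W q n [] y \<le> G * (ennreal (\<theta> ^ length y) * Lw y)"
        by (simp add: mult_ac)
    qed
    then show ?thesis by (simp add: nn_integral_cmult K)
  qed
  then show ?thesis by (intro exI[of _ K]) (simp add: K_def)
qed

end

section \<open>Return probabilities of the walk\<close>

context free_walk_at
begin

text \<open>In the factor, \<open>1 - 1 / Gr i s\<close> is the generating function of the first return to the root.\<close>

lemma ur_eq:
  assumes i: "i \<in> I" and \<xi>1: "\<xi> i < 1"
  shows "ur i = (1 - H i) * (1 - 1 / Gr i (\<xi> i))"
proof -
  note \<xi>0 = less_imp_le[OF \<xi>_pos[OF i]]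
  let ?g = "Gr i (\<xi> i)"
  have g: "1 \<le> ?g" using Gr_bounds[OF i \<xi>0 \<xi>1] by simp
  have U: "ennreal ?g = 1 + Uf i * ennreal ?g"
    using kgreen_return_hit[OF rt_in[OF i], of "qf i"] unfolding kgreen_factor[OF i \<xi>0 \<xi>1] Uf_def by simp
  have "Uf i \<noteq> \<infinity>"
  proof
    assume "Uf i = \<infinity>"
    with U g show False by (simp add: ennreal_top_mult)
  qed
  then obtain x where x: "Uf i = ennreal x" "0 \<le> x" by (cases "Uf i") auto
  then have "ennreal ?g = ennreal (1 + x * ?g)" using U g by (simp add: ennreal_mult'')
  then have "?g = 1 + x * ?g" using g x by (subst (asm) ennreal_inj) auto
  then have "x = 1 - 1 / ?g" using g by (simp add: field_simps)
  moreover have "ennreal (ur i) = ennreal ((1 - H i) * x)"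
    using u_eq[OF i] u_ur[OF i] x H_bounds(2)[OF i] by (simp add: ennreal_mult'')
  then have "ur i = (1 - H i) * x"
    using ur_nonneg[of i] x H_bounds(2)[OF i] by (subst (asm) ennreal_inj) auto
  ultimately show ?thesis by simp
qed

text \<open>A first step outside of the factor \<open>i\<close> ends in \<open>V j\<close> for some \<open>j \<noteq> i\<close>; the step from the root of \<open>V j\<close>
to itself has probability \<open>0\<close>.\<close>

lemma Hbar_integral:
  assumes i: "i \<in> I"
  shows "(\<integral>\<^sup>+y. q [] y * F y \<partial>count_space (W - factor_in_product V rt i)) = ennreal (H i)"
proof -
  let ?f = "\<lambda>y. F y * indicator (- factor_in_product V rt i) y"
  have "(\<integral>\<^sup>+y. q [] y * F y \<partial>count_space (W - factor_in_product V rt i)) = (\<integral>\<^sup>+y. q [] y * ?f y \<partial>count_space W)"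
    by (subst (1 2) nn_integral_count_space_indicator) (auto intro!: nn_integral_cong split: split_indicator)
  also have "\<dots> = (\<Sum>j\<in>I. \<integral>\<^sup>+w. ennreal (z * \<alpha> j * p j (rt j) w) * ?f (app (rt j) [] w) \<partial>count_space (V j))"
    using row_operator[OF Nil_in_W less_imp_le[OF z_pos], of ?f] by simp
  also have "\<dots> = (\<Sum>j\<in>I. if j = i then 0 else u j)"
  proof (rule sum.cong[OF refl])
    fix j assume j: "j \<in> I"
    show "(\<integral>\<^sup>+w. ennreal (z * \<alpha> j * p j (rt j) w) * ?f (app (rt j) [] w) \<partial>count_space (V j)) = (if j = i then 0 else u j)"
    proof (cases "j = i")
      case True
      then show ?thesis by (auto simp: factor_in_product_def nn_integral_0_iff_AE AE_count_space)
    next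
      case False
      have "(\<integral>\<^sup>+w. ennreal (z * \<alpha> j * p j (rt j) w) * ?f (app (rt j) [] w) \<partial>count_space (V j)) = u j"
        unfolding u_def
      proof (intro nn_integral_cong)
        fix w assume "w \<in> space (count_space (V j))"
        then have w: "w \<in> V j" by simp
        show "ennreal (z * \<alpha> j * p j (rt j) w) * ?f (app (rt j) [] w) =
            ennreal (z * \<alpha> j * p j (rt j) w) * F (app (rt j) [] w)"
        proof (cases "w = rt j")
          case True
          then show ?thesis using p_diag[OF j rt_in[OF j]] by simp
        next
          case False2: False
          have "w \<notin> V i" using factor_unique[OF i j _ w] False by blast
          then have "app (rt j) [] w \<notin> factor_in_product V rt i"
            using False2 by (auto simp: factor_in_product_def app_def split: if_splits)
          then show ?thesis by simp
        qed
      qed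
      then show ?thesis using False by simp
    qed
  qed
  also have "\<dots> = (\<Sum>j\<in>I - {i}. u j)"
    by (rule sum.mono_neutral_cong_right) auto
  finally show ?thesis using u_sum_real[of "I - {i}"] by (simp add: H_def)
qed

lemma Hbar_eq:
  assumes mc: "markov_chain_from M W P [] Z" and i: "i \<in> I"
  shows "Hbar M Z V rt i z = H i"
    and "summable (\<lambda>n. if 2 \<le> n then measure M {\<omega> \<in> space M. return_time Z [] \<omega> = enat n \<and>
           Z 1 \<omega> \<notin> factor_in_product V rt i} * z ^ n else 0)" (is "summable ?h")
proof -
  have rt: "[] \<in> factor_in_product V rt i"
    using rt_in[OF i] unfolding factor_in_product_def app_def by force
  have nn: "0 \<le> ?h n" for n using z_pos by simp
  have "(\<Sum>n. ennreal (?h n)) = (\<integral>\<^sup>+y. q [] y * F y \<partial>count_space (W - factor_in_product V rt i))"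
    by (rule first_return_series[OF mc W_countable]) (use P_nonneg rt z_pos in auto)
  then have e: "(\<Sum>n. ennreal (?h n)) = ennreal (H i)" using Hbar_integral[OF i] by simp
  then show sm: "summable ?h" by (intro summable_suminf_not_top[OF nn]) simp
  have "ennreal (suminf ?h) = ennreal (H i)" using e suminf_ennreal2[OF nn sm] by simp
  then show "Hbar M Z V rt i z = H i"
    unfolding Hbar_def using H_bounds(1)[of i] suminf_nonneg[OF sm nn] by (subst (asm) ennreal_inj) auto
qed

end

section \<open>Return and escape probabilities at \<open>z = 1\<close>\<close>

locale free_walk_at_1 = free_walk_at r V rt p \<alpha> 1 for r V rt p \<alpha>
begin

lemma ur_le: "i \<in> I \<Longrightarrow> ur i \<le> \<alpha> i"
proof -
  assume i: "i \<in> I"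
  have F1: "F x \<le> 1" if "x \<in> W" for x
    by (rule hit_minimal[where h = "\<lambda>_. 1"])
      (use that transition_matrix_sum[OF P_transition] in auto)
  have "u i \<le> (\<integral>\<^sup>+w. ennreal (\<alpha> i * p i (rt i) w) * 1 \<partial>count_space (V i))"
    unfolding u_def
  proof (intro nn_integral_mono)
    fix w assume "w \<in> space (count_space (V i))"
    then have "F (app (rt i) [] w) \<le> 1" using i by (intro F1 app_in_W) auto
    from mult_left_mono[OF this, of "ennreal (\<alpha> i * p i (rt i) w)"]
    show "ennreal (1 * \<alpha> i * p i (rt i) w) * F (app (rt i) [] w) \<le> ennreal (\<alpha> i * p i (rt i) w) * 1" by simp
  qed
  also have "\<dots> = ennreal (\<alpha> i)"
    using factor_row_sum[OF i rt_in[OF i], of "\<alpha> i"] \<alpha>_pos[OF i] by simp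
  finally show ?thesis using \<alpha>_pos[OF i] by (simp add: u_ur[OF i] ennreal_le_iff)
qed

lemma H_plus_\<alpha>: "i \<in> I \<Longrightarrow> 1 - H i - \<alpha> i = (\<Sum>j\<in>I - {i}. \<alpha> j - ur j)"
  using \<alpha>_sum by (simp add: H_def sum_subtractf sum_diff1)

lemma \<xi>_le_1: "i \<in> I \<Longrightarrow> \<xi> i \<le> 1"
proof -
  assume i: "i \<in> I"
  have "0 \<le> (\<Sum>j\<in>I - {i}. \<alpha> j - ur j)" using ur_le by (intro sum_nonneg) auto
  then show ?thesis using H_plus_\<alpha>[OF i] H_bounds(2)[OF i] by (simp add: \<xi>_def)
qed

text \<open>A return to the root of a factor takes at least two steps, since \<open>p i x x = 0\<close>.\<close>

lemma ur_le_\<xi>: "i \<in> I \<Longrightarrow> ur i \<le> \<alpha> i * \<xi> i"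
proof -
  assume i: "i \<in> I"
  note \<xi>i = \<xi>_pos[OF i] \<xi>_le_1[OF i]
  have row: "(\<integral>\<^sup>+w. qf i v w \<partial>count_space (V i)) = ennreal (\<xi> i)" if "v \<in> V i" for v
    using factor_row_sum[OF i that, of "\<xi> i"] \<xi>i by simp
  have "Ff i v \<le> (if v = rt i then 1 else ennreal (\<xi> i))" if "v \<in> V i" for v
  proof (rule hit_minimal[OF _ _ that])
    fix x assume x: "x \<in> V i" "x \<noteq> rt i"
    have "(\<integral>\<^sup>+w. qf i x w * (if w = rt i then 1 else ennreal (\<xi> i)) \<partial>count_space (V i)) \<le>
        (\<integral>\<^sup>+w. qf i x w * 1 \<partial>count_space (V i))"
      using \<xi>i by (intro nn_integral_mono mult_left_mono) (auto simp: ennreal_le_1)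
    then show "(\<integral>\<^sup>+w. qf i x w * (if w = rt i then 1 else ennreal (\<xi> i)) \<partial>count_space (V i)) \<le>
        (if x = rt i then 1 else ennreal (\<xi> i))" using x row by simp
  qed simp
  then have "Uf i \<le> (\<integral>\<^sup>+w. qf i (rt i) w * ennreal (\<xi> i) \<partial>count_space (V i))"
    unfolding Uf_def
  proof (intro nn_integral_mono)
    fix w assume *: "\<And>v. v \<in> V i \<Longrightarrow> Ff i v \<le> (if v = rt i then 1 else ennreal (\<xi> i))"
      and "w \<in> space (count_space (V i))"
    then show "qf i (rt i) w * Ff i w \<le> qf i (rt i) w * ennreal (\<xi> i)"
      using p_diag[OF i rt_in[OF i]] *[of w] by (cases "w = rt i") (auto intro: mult_left_mono)
  qed
  also have "\<dots> = ennreal (\<xi> i) * ennreal (\<xi> i)"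
    by (subst nn_integral_multc, simp) (simp only: row[OF rt_in[OF i]])
  also have "\<dots> = ennreal (\<xi> i * \<xi> i)" using \<xi>i by (simp add: ennreal_mult')
  finally have "ennreal (1 - H i) * Uf i \<le> ennreal (1 - H i) * ennreal (\<xi> i * \<xi> i)" by (rule mult_left_mono) simp
  also have "\<dots> = ennreal ((1 - H i) * (\<xi> i * \<xi> i))"
    using H_bounds(2)[OF i] by (intro ennreal_mult'[symmetric]) simp
  also have "(1 - H i) * (\<xi> i * \<xi> i) = \<alpha> i * \<xi> i" using H_bounds(2)[OF i] by (simp add: \<xi>_def)
  finally show ?thesis using \<alpha>_pos[OF i] \<xi>i by (simp add: u_eq[OF i, symmetric] u_ur[OF i])
qed

text \<open>If \<open>\<xi> i = 1\<close>, then the walk returns almost surely after a first step into any other factor \<open>j\<close>,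
  whence \<open>\<xi> j = 1\<close> by \<open>ur_le_\<xi>\<close>. With the roles of \<open>i\<close> and \<open>j\<close> exchanged it also returns after a
  first step into \<open>V i\<close>, against transience.\<close>

lemma \<xi>_less_1: "i \<in> I \<Longrightarrow> \<xi> i < 1"
proof (rule ccontr)
  assume i: "i \<in> I" and "\<not> \<xi> i < 1"
  then have \<xi>i: "\<xi> i = 1" using \<xi>_le_1[OF i] by simp
  have ret: "ur j = \<alpha> j" if k: "k \<in> I" "\<xi> k = 1" and j: "j \<in> I - {k}" for j k
  proof -
    have "1 - H k - \<alpha> k = 0" using k H_bounds(2)[OF k(1)] by (simp add: \<xi>_def)
    then have "(\<Sum>j\<in>I - {k}. \<alpha> j - ur j) = 0" using H_plus_\<alpha>[OF k(1)] by simp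
    then have "\<forall>j\<in>I - {k}. \<alpha> j - ur j = 0" using ur_le by (subst (asm) sum_nonneg_eq_0_iff) auto
    then show ?thesis using j by auto
  qed
  have "(if i = 1 then 2 else 1) \<in> I - {i}" using r2 by auto
  then obtain j where j: "j \<in> I - {i}" by blast
  have "\<alpha> j \<le> \<alpha> j * \<xi> j" using ur_le_\<xi>[of j] ret[OF i \<xi>i j] j by simp
  then have "\<xi> j = 1" using \<alpha>_pos[of j] \<xi>_le_1[of j] j by simp
  then have "ur k = \<alpha> k" if "k \<in> I" for k
    using ret[OF i \<xi>i, of k] ret[of j k] i j that by (cases "k = i") auto
  then have "(\<Sum>k\<in>I. ur k) = 1" using \<alpha>_sum by simp
  then show False using ur_sum_less by simp
qed

text \<open>So the transfer matrix of the factors has the eigenvalue \<open>1\<close> at \<open>z = 1\<close>. By \<open>ur_eq\<close> all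
the terms can be written with \<open>ur\<close> and \<open>\<alpha>\<close> over the common denominator \<open>1 - (\<Sum>j\<in>I. ur j)\<close>.\<close>

lemma A_sum: "(\<Sum>i\<in>I. A i (\<xi> i) / (1 + A i (\<xi> i))) = 1"
proof -
  define S where "S = (\<Sum>j\<in>I. ur j)"
  have S: "S < 1" using ur_sum_less by (simp add: S_def)
  have "A i (\<xi> i) / (1 + A i (\<xi> i)) = 1 - (1 - S + ur i - \<alpha> i) / (1 - S)" if i: "i \<in> I" for i
  proof -
    note \<xi>i = \<xi>_pos[OF i] \<xi>_less_1[OF i]
    let ?g = "Gr i (\<xi> i)"
    have g: "1 \<le> ?g" using Gr_bounds[OF i less_imp_le[OF \<xi>i(1)] \<xi>i(2)] by simp
    have H: "H i = S - ur i" using H_eq[OF i] by (simp add: S_def)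
    have c: "0 < 1 - H i" using H_bounds(2)[OF i] by simp
    have "ur i = (1 - H i) - (1 - H i) / ?g" using ur_eq[OF i \<xi>i(2)] by (simp add: right_diff_distrib)
    then have "(1 - H i) / ?g = 1 - S" using H by simp
    then have "?g = (1 - H i) / (1 - S)" using S g by (simp add: field_simps)
    moreover have "(1 - \<xi> i) * (1 - H i) = 1 - H i - \<alpha> i" using c by (simp add: \<xi>_def left_diff_distrib)
    ultimately have "(1 - \<xi> i) * ?g = (1 - S + ur i - \<alpha> i) / (1 - S)" using H by simp
    moreover have "A i (\<xi> i) / (1 + A i (\<xi> i)) = 1 - (1 - \<xi> i) * ?g"
      using g \<xi>i by (simp add: A_def field_simps)
    ultimately show ?thesis by simp
  qed
  then have "(\<Sum>i\<in>I. A i (\<xi> i) / (1 + A i (\<xi> i))) = (\<Sum>i\<in>I. 1 - (1 - S + ur i - \<alpha> i) / (1 - S))" by simp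
  also have "\<dots> = real r - (\<Sum>i\<in>I. 1 - S + ur i - \<alpha> i) / (1 - S)"
    by (subst sum_subtractf) (simp add: sum_divide_distrib[symmetric])
  also have "(\<Sum>i\<in>I. 1 - S + ur i - \<alpha> i) = (real r - 1) * (1 - S)"
    using \<alpha>_sum by (simp add: sum_subtractf sum.distrib S_def algebra_simps)
  finally show ?thesis using S by simp
qed

end

section \<open>Large deviations and the rate of escape\<close>

lemma eventually_less_along:
  fixes f :: "real \<Rightarrow> real"
  assumes "isCont f 0" "f 0 < b"
  shows "\<forall>\<^sub>F t in at_right 0. f (e * t) < b"
proof -
  have "isCont (\<lambda>t. f (e * t)) 0"
    using assms(1) by (intro continuous_intros isCont_o2[of 0 "\<lambda>t. e * t" f]) auto
  then have "((\<lambda>t. f (e * t)) \<longlongrightarrow> f 0) (at 0)" by (simp add: isCont_def)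
  then have "((\<lambda>t. f (e * t)) \<longlongrightarrow> f 0) (at_right 0)" by (rule tendsto_within_subset) simp
  then show ?thesis using assms(2) by (rule order_tendstoD)
qed

lemma eventually_decreasing_along:
  fixes f :: "real \<Rightarrow> real"
  assumes "(f has_real_derivative D) (at 0)" "e * D < 0"
  shows "\<forall>\<^sub>F t in at_right 0. f (e * t) < f 0"
proof -
  have "((\<lambda>t. f (e * t)) has_real_derivative D * e) (at 0)"
    by (rule DERIV_chain2[where f = f]) (use assms(1) in \<open>auto intro!: derivative_eq_intros\<close>)
  from DERIV_neg_dec_right[OF this] assms(2)
  obtain d where d: "0 < d" "\<And>h. 0 < h \<Longrightarrow> h < d \<Longrightarrow> f (e * h) < f 0" by (auto simp: mult.commute)
  then show ?thesis unfolding eventually_at_right_field by (intro exI[of _ d]) auto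
qed

locale free_walk_chain = free_walk +
  fixes M :: "'w measure" and Z :: "nat \<Rightarrow> 'w \<Rightarrow> 'a list"
  assumes conv: "conv_radius (\<lambda>n. nstep W P n [] []) > 1"
    and chain: "markov_chain_from M W P [] Z"
begin

abbreviation "X \<equiv> xi M Z V rt \<alpha>"

lemma prob_space_M: "prob_space M"
  using chain unfolding markov_chain_from_def by blast

lemma Z_measurable: "Z n \<in> measurable M (count_space W)"
  using chain unfolding markov_chain_from_def by blast

lemma Z_event: "{\<omega> \<in> space M. Q (Z n \<omega>)} \<in> sets M"
  by (rule measurable_sets_Collect[OF Z_measurable]) simp

text \<open>The whole interval around \<open>1\<close> is needed, as upper deviations use \<open>z < 1\<close> and lower deviations \<open>z > 1\<close>.\<close>

lemma convergence_radius: "\<exists>z0>1. \<forall>z. 0 < z \<longrightarrow> z \<le> z0 \<longrightarrow> free_walk_at r V rt p \<alpha> z"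
proof -
  obtain z0 where z0: "1 < ereal z0" "ereal z0 < conv_radius (\<lambda>n. nstep W P n [] [])"
    using ereal_dense2[OF conv] by auto
  have "free_walk_at r V rt p \<alpha> z" if z: "0 < z" "z \<le> z0" for z
  proof unfold_locales
    have "ereal (norm z) \<le> ereal z0" using z by simp
    then have "ereal (norm z) < conv_radius (\<lambda>n. nstep W P n [] [])" using z0(2) by (rule order.strict_trans1)
    then have "summable (\<lambda>n. nstep W P n [] [] * z ^ n)" by (rule summable_in_conv_radius)
    from kgreen_eq_green[OF P_transition Nil_in_W less_imp_le[OF z(1)] this]
    show "kgreen W (\<lambda>x y. ennreal (z * P x y)) [] [] < \<infinity>" by simp
  qed (rule z)
  with z0(1) show ?thesis by (intro exI[of _ z0]) auto
qed

lemma xi_eq: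
  assumes "free_walk_at r V rt p \<alpha> z" "i \<in> I"
  shows "X i z = free_walk_at.\<xi> r V rt p \<alpha> z i"
proof -
  interpret w: free_walk_at r V rt p \<alpha> z by fact
  show ?thesis unfolding xi_def w.\<xi>_def w.Hbar_eq(1)[OF chain assms(2)] ..
qed

lemma expectation_marginal:
  "(\<integral>\<^sup>+\<omega>. g (Z n \<omega>) \<partial>M) = (\<integral>\<^sup>+y. g y * kpow W (\<lambda>x y. ennreal (P x y)) n [] y \<partial>count_space W)"
proof -
  have "(\<integral>\<^sup>+\<omega>. g (Z n \<omega>) \<partial>M) = (\<integral>\<^sup>+\<omega>. \<integral>\<^sup>+y. g y * indicator {\<omega> \<in> space M. Z n \<omega> = y} \<omega> \<partial>count_space W \<partial>M)"
  proof (rule nn_integral_cong)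
    fix \<omega> assume w: "\<omega> \<in> space M"
    then have "Z n \<omega> \<in> W" using measurable_space[OF Z_measurable] by auto
    then have "(\<integral>\<^sup>+y. g y * (if y = Z n \<omega> then 1 else 0) \<partial>count_space W) = g (Z n \<omega>)"
      by (rule nn_integral_count_space_delta)
    moreover have "(\<integral>\<^sup>+y. g y * indicator {\<omega> \<in> space M. Z n \<omega> = y} \<omega> \<partial>count_space W) =
        (\<integral>\<^sup>+y. g y * (if y = Z n \<omega> then 1 else 0) \<partial>count_space W)"
      using w by (intro nn_integral_cong) (auto split: split_indicator)
    ultimately show "g (Z n \<omega>) = (\<integral>\<^sup>+y. g y * indicator {\<omega> \<in> space M. Z n \<omega> = y} \<omega> \<partial>count_space W)" by simp
  qed
  also have "\<dots> = (\<integral>\<^sup>+y. \<integral>\<^sup>+\<omega>. g y * indicator {\<omega> \<in> space M. Z n \<omega> = y} \<omega> \<partial>M \<partial>count_space W)"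
    by (rule nn_integral_count_space_nn_integral[OF W_countable]) (use Z_event[of "\<lambda>x. x = _"] in measurable)
  also have "\<dots> = (\<integral>\<^sup>+y. g y * kpow W (\<lambda>x y. ennreal (P x y)) n [] y \<partial>count_space W)"
    using markov_chain_marginal[OF chain W_countable P_nonneg Nil_in_W]
    by (intro nn_integral_cong) (simp add: nn_integral_cmult_indicator Z_event[of "\<lambda>x. x = _"])
  finally show ?thesis .
qed

text \<open>The bound on \<open>\<theta> ^ length (Z n \<omega>)\<close> in the mean is of order \<open>z powr (- n)\<close>. The condition
on \<open>\<theta> powr (- c)\<close> makes the resulting tail probabilities summable.\<close>

lemma chernoff:
  assumes at: "free_walk_at r V rt p \<alpha> z" and X1: "\<And>i. i \<in> I \<Longrightarrow> X i z < 1" and \<rho>: "0 < \<rho>"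
    and sum1: "(\<Sum>i\<in>I. A i (X i z) / (\<rho> + A i (X i z))) \<le> 1"
    and \<theta>: "0 < \<theta>" "\<theta> * \<rho> < 1" and small: "\<theta> powr (- c) < z"
  shows "AE \<omega> in M. \<forall>\<^sub>F n in sequentially. \<theta> ^ length (Z n \<omega>) < \<theta> powr (c * real n)"
proof -
  interpret w: free_walk_at r V rt p \<alpha> z by (rule at)
  interpret M: prob_space M by (rule prob_space_M)
  have z: "0 < z" by (rule w.z_pos)
  have "\<exists>K\<ge>0. \<forall>n. (\<integral>\<^sup>+y. ennreal (\<theta> ^ length y) * kpow W w.q n [] y \<partial>count_space W) \<le> ennreal K"
    by (rule w.exponential_moment[OF _ \<rho> _ \<theta>]) (use X1 sum1 in \<open>auto simp: xi_eq[OF at]\<close>)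
  then obtain K where K: "0 \<le> K" "\<And>n. (\<integral>\<^sup>+y. ennreal (\<theta> ^ length y) * kpow W w.q n [] y \<partial>count_space W) \<le> ennreal K"
    by blast
  define \<eta> where "\<eta> = \<theta> powr (- c) / z"
  have \<eta>: "0 < \<eta>" "\<eta> < 1" using \<theta> z small by (auto simp: \<eta>_def)
  define E where "E n = {\<omega> \<in> space M. \<theta> powr (c * real n) \<le> \<theta> ^ length (Z n \<omega>)}" for n
  have Em: "E n \<in> sets M" for n unfolding E_def by (rule Z_event)
  have PE: "measure M (E n) \<le> K * \<eta> ^ n" for n
  proof -
    have "ennreal (z ^ n * \<theta> powr (c * real n) * measure M (E n)) =
        ennreal (z ^ n) * (\<integral>\<^sup>+\<omega>. ennreal (\<theta> powr (c * real n)) * indicator (E n) \<omega> \<partial>M)"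
      using z Em by (simp add: nn_integral_cmult_indicator M.emeasure_eq_measure ennreal_mult mult.assoc)
    also have "\<dots> \<le> ennreal (z ^ n) * (\<integral>\<^sup>+\<omega>. ennreal (\<theta> ^ length (Z n \<omega>)) \<partial>M)"
      by (intro mult_left_mono nn_integral_mono) (auto simp: E_def intro!: ennreal_leI split: split_indicator)
    also have "\<dots> = (\<integral>\<^sup>+y. ennreal (z ^ n) * (ennreal (\<theta> ^ length y) * kpow W (\<lambda>x y. ennreal (P x y)) n [] y) \<partial>count_space W)"
      unfolding expectation_marginal[where g = "\<lambda>y. ennreal (\<theta> ^ length y)"] by (rule nn_integral_cmult[symmetric]) simp
    also have "\<dots> = (\<integral>\<^sup>+y. ennreal (\<theta> ^ length y) * kpow W w.q n [] y \<partial>count_space W)"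
      unfolding kpow_scale[OF less_imp_le[OF z]] by (simp only: mult_ac)
    also have "\<dots> \<le> ennreal K" by (rule K)
    finally have "z ^ n * \<theta> powr (c * real n) * measure M (E n) \<le> K"
      using K(1) by (simp add: ennreal_le_iff)
    moreover have "\<eta> ^ n = inverse (z ^ n * \<theta> powr (c * real n))"
      using \<theta> z by (simp add: \<eta>_def power_divide powr_minus powr_powr powr_realpow[symmetric] power_inverse field_simps)
    moreover have "0 < z ^ n * \<theta> powr (c * real n)" using z \<theta> by simp
    ultimately show ?thesis by (simp add: field_simps)
  qed
  have "AE \<omega> in M. \<forall>\<^sub>F n in sequentially. \<omega> \<in> space M - E n"
  proof (rule borel_cantelli_AE1[OF Em])
    show "emeasure M (E n) < \<infinity>" for n by (simp add: M.emeasure_eq_measure)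
    show "summable (\<lambda>n. measure M (E n))"
    proof (rule summable_comparison_test'[of _ 0])
      show "summable (\<lambda>n. K * \<eta> ^ n)" using \<eta> by (intro summable_mult summable_geometric) simp
    qed (use PE in simp)
  qed
  then show ?thesis
    by (rule AE_mp) (auto intro!: AE_I2 elim!: eventually_mono simp: E_def)
qed

lemma Hbar_deriv:
  assumes i: "i \<in> I"
  obtains D where "0 \<le> D" "(Hbar M Z V rt i has_real_derivative D) (at 1)"
proof -
  obtain z0 where z0: "1 < z0" "free_walk_at r V rt p \<alpha> z0" using convergence_radius by force
  interpret w: free_walk_at r V rt p \<alpha> z0 by (rule z0)
  define c where "c n = (if 2 \<le> n then measure M {\<omega> \<in> space M. return_time Z [] \<omega> = enat n \<and>
      Z 1 \<omega> \<notin> factor_in_product V rt i} else 0)" for n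
  have H: "Hbar M Z V rt i = (\<lambda>z. \<Sum>n. c n * z ^ n)"
    unfolding Hbar_def c_def by (intro ext arg_cong[where f = suminf]) auto
  have sm: "summable (\<lambda>n. c n * z0 ^ n)"
    using w.Hbar_eq(2)[OF chain i] by (rule summable_cong[THEN iffD1, rotated]) (auto simp: c_def)
  have "((\<lambda>z. \<Sum>n. c n * z ^ n) has_real_derivative (\<Sum>n. diffs c n * 1 ^ n)) (at 1)"
    by (rule termdiffs_strong[OF sm]) (use z0 in auto)
  moreover have "0 \<le> (\<Sum>n. diffs c n * 1 ^ n)"
  proof (rule suminf_nonneg)
    show "summable (\<lambda>n. diffs c n * 1 ^ n)"
    proof (rule termdiff_converges[of 1 z0])
      show "summable (\<lambda>n. c n * x ^ n)" if "norm x < z0" for x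
        using powser_inside[OF sm, of x] that z0 by simp
    qed (use z0 in auto)
  qed (simp add: diffs_def c_def)
  ultimately show ?thesis using that unfolding H by blast
qed

lemma at_1: "free_walk_at_1 r V rt p \<alpha>"
proof -
  have "free_walk_at r V rt p \<alpha> 1" using convergence_radius by force
  then show ?thesis by (simp add: free_walk_at_1_def)
qed

lemma X_1: "i \<in> I \<Longrightarrow> 0 < X i 1" "i \<in> I \<Longrightarrow> X i 1 < 1"
  and A_X_1: "(\<Sum>i\<in>I. A i (X i 1) / (1 + A i (X i 1))) = 1"
proof -
  interpret w: free_walk_at_1 r V rt p \<alpha> by (rule at_1)
  note eq = xi_eq[OF w.free_walk_at_axioms]
  show "i \<in> I \<Longrightarrow> 0 < X i 1" "i \<in> I \<Longrightarrow> X i 1 < 1" using w.\<xi>_pos w.\<xi>_less_1 by (simp_all add: eq)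
  have "(\<Sum>i\<in>I. A i (X i 1) / (1 + A i (X i 1))) = (\<Sum>i\<in>I. A i (w.\<xi> i) / (1 + A i (w.\<xi> i)))"
    by (rule sum.cong) (simp_all only: eq)
  then show "(\<Sum>i\<in>I. A i (X i 1) / (1 + A i (X i 1))) = 1" using w.A_sum by simp
qed

lemma X_deriv:
  assumes i: "i \<in> I"
  shows "(X i has_real_derivative deriv (X i) 1) (at 1)" "0 < deriv (X i) 1"
proof -
  interpret w: free_walk_at_1 r V rt p \<alpha> by (rule at_1)
  obtain D where D: "0 \<le> D" "(Hbar M Z V rt i has_real_derivative D) (at 1)" by (rule Hbar_deriv[OF i])
  have h: "Hbar M Z V rt i 1 < 1" using w.Hbar_eq(1)[OF chain i] w.H_bounds(2)[OF i] by simp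
  let ?D = "(\<alpha> i * (1 - Hbar M Z V rt i 1) + \<alpha> i * D) / (1 - Hbar M Z V rt i 1)\<^sup>2"
  have d: "(X i has_real_derivative ?D) (at 1)"
    unfolding xi_def[abs_def] using h
    by (auto intro!: derivative_eq_intros D(2) simp: power2_eq_square)
  then show "(X i has_real_derivative deriv (X i) 1) (at 1)" using DERIV_imp_deriv by fastforce
  have "0 < ?D" using h D(1) \<alpha>_pos[OF i] by (intro divide_pos_pos add_pos_nonneg) auto
  then show "0 < deriv (X i) 1" using DERIV_imp_deriv[OF d] by simp
qed

definition num :: real where
  "num = (\<Sum>i\<in>I. (1 - (1 - X i 1) * Gr i (X i 1)) * Gr i (X i 1) * (1 - X i 1))"

definition den :: real where
  "den = (\<Sum>i\<in>I. deriv (X i) 1 * (Gr i (X i 1) - (1 - X i 1) * deriv (Gr i) (X i 1)))"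

lemma A_X_facts:
  assumes i: "i \<in> I"
  defines "b \<equiv> (1 - X i 1) * Gr i (X i 1)"
  shows "0 < b" "1 + A i (X i 1) = 1 / b" "0 < A i (X i 1)"
  using Gr_bounds(1)[OF i less_imp_le[OF X_1(1)[OF i]] X_1(2)[OF i]] X_1[OF i] A_pos[OF i X_1[OF i]]
  by (auto simp: b_def A_def)

lemma num_pos: "0 < num" and den_pos: "0 < den"
proof -
  have I: "finite I" "I \<noteq> {}" using r2 by auto
  show "0 < num" unfolding num_def
  proof (rule sum_pos[OF I])
    fix i assume i: "i \<in> I"
    note f = A_X_facts[OF i]
    have "1 < 1 / ((1 - X i 1) * Gr i (X i 1))" using f(2,3) by linarith
    then have "1 - (1 - X i 1) * Gr i (X i 1) > 0" using f(1) by (subst (asm) less_divide_eq_1_pos) auto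
    then show "0 < (1 - (1 - X i 1) * Gr i (X i 1)) * Gr i (X i 1) * (1 - X i 1)"
      using f(1) by (simp add: mult.assoc mult.commute[of "Gr i (X i 1)"])
  qed
  show "0 < den" unfolding den_def
  proof (rule sum_pos[OF I])
    fix i assume i: "i \<in> I"
    show "0 < deriv (X i) 1 * (Gr i (X i 1) - (1 - X i 1) * deriv (Gr i) (X i 1))"
      using X_deriv(2)[OF i] A_deriv(2)[OF i X_1[OF i]] A_X_facts(1)[OF i] by (simp add: zero_less_divide_iff)
  qed
qed

text \<open>The derivative of the eigenvalue condition of the transfer matrix in the direction \<open>(1, \<kappa>)\<close>.\<close>

lemma eigenvalue_deriv:
  "((\<lambda>s. \<Sum>i\<in>I. A i (X i (1 + s)) / (1 + \<kappa> * s + A i (X i (1 + s)))) has_real_derivative den - \<kappa> * num) (at 0)"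
proof -
  have summand: "((\<lambda>s. A i (X i (1 + s)) / (1 + \<kappa> * s + A i (X i (1 + s)))) has_real_derivative
      deriv (X i) 1 * (Gr i (X i 1) - (1 - X i 1) * deriv (Gr i) (X i 1)) -
      \<kappa> * ((1 - (1 - X i 1) * Gr i (X i 1)) * Gr i (X i 1) * (1 - X i 1))) (at 0)" if i: "i \<in> I" for i
  proof -
    define b where "b = (1 - X i 1) * Gr i (X i 1)"
    define n where "n = Gr i (X i 1) - (1 - X i 1) * deriv (Gr i) (X i 1)"
    have b: "0 < b" "1 + A i (X i 1) = 1 / b" using A_X_facts[OF i] by (simp_all add: b_def)
    have X: "((\<lambda>s. X i (1 + s)) has_real_derivative deriv (X i) 1) (at 0)"
      using DERIV_shift[of "X i" "deriv (X i) 1" 0 1] X_deriv(1)[OF i] by (simp add: add.commute)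
    have a: "((\<lambda>s. A i (X i (1 + s))) has_real_derivative n / b\<^sup>2 * deriv (X i) 1) (at 0)"
      by (rule DERIV_chain2[where f = "A i"])
        (use A_deriv(1)[OF i X_1[OF i]] X in \<open>simp_all add: b_def n_def\<close>)
    have "((\<lambda>s. A i (X i (1 + s)) / (1 + \<kappa> * s + A i (X i (1 + s)))) has_real_derivative
        (n / b\<^sup>2 * deriv (X i) 1 * (1 / b) - A i (X i 1) * (\<kappa> + n / b\<^sup>2 * deriv (X i) 1)) / (1 / b)\<^sup>2) (at 0)"
      using b by (auto intro!: derivative_eq_intros a simp: power2_eq_square)
    also have "A i (X i 1) = 1 / b - 1" using b by simp
    also have "(n / b\<^sup>2 * deriv (X i) 1 * (1 / b) - (1 / b - 1) * (\<kappa> + n / b\<^sup>2 * deriv (X i) 1)) / (1 / b)\<^sup>2 =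
        deriv (X i) 1 * n - \<kappa> * ((1 - b) * b)"
      using b(1) by (simp add: field_simps power2_eq_square)
    finally show ?thesis by (simp add: b_def n_def mult_ac)
  qed
  have "den - \<kappa> * num = (\<Sum>i\<in>I. deriv (X i) 1 * (Gr i (X i 1) - (1 - X i 1) * deriv (Gr i) (X i 1)) -
      \<kappa> * ((1 - (1 - X i 1) * Gr i (X i 1)) * Gr i (X i 1) * (1 - X i 1)))"
    by (simp add: den_def num_def sum_subtractf sum_distrib_left)
  then show ?thesis by (simp only:) (intro DERIV_sum summand)
qed

text \<open>With \<open>m = den / num\<close> the eigenvalue of the transfer matrix at \<open>z = 1 + s\<close> is \<open>1 + m s\<close> to first order.
The constants \<open>\<kappa>\<close> and \<open>\<kappa>'\<close> divide the interval between \<open>m\<close> and \<open>1 / c\<close>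
into three equal parts: a nonzero \<open>\<kappa> - m\<close> gives room for the eigenvalue inequality,
\<open>\<kappa>' - \<kappa>\<close> for the geometric series, and \<open>1 / c - \<kappa>'\<close> for exponential decay. The sign of \<open>s\<close>
is chosen such that all three have the right sign.\<close>

lemma deviation:
  assumes c: "0 < c" "c \<noteq> num / den"
  shows "AE \<omega> in M. \<forall>\<^sub>F n in sequentially.
    if num / den < c then real (length (Z n \<omega>)) < c * real n else c * real n < real (length (Z n \<omega>))"
proof -
  define m where "m = den / num"
  define \<kappa> where "\<kappa> = (2 * m + 1 / c) / 3"
  define \<kappa>' where "\<kappa>' = (m + 2 / c) / 3"
  define e where "e = sgn (1 / c - m)"
  have m: "0 < m" using num_pos den_pos by (simp add: m_def)
  have ne: "1 / c \<noteq> m" using c num_pos den_pos by (auto simp: m_def field_simps)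
  have e: "e = 1 \<or> e = - 1" using ne by (auto simp: e_def sgn_if)
  have em: "e * (m - 1 / c) < 0" using ne by (auto simp: e_def sgn_if)
  have "m - \<kappa> = (m - 1 / c) / 3" "c * \<kappa>' - 1 = (m - 1 / c) * (c / 3)" "\<kappa> - \<kappa>' = (m - 1 / c) / 3"
    using c(1) by (simp_all add: \<kappa>_def \<kappa>'_def field_simps)
  then have sgn: "e * (m - \<kappa>) < 0" "e * (c * \<kappa>' - 1) < 0" "e * (\<kappa> - \<kappa>') < 0"
    using em mult_neg_pos[OF em, of "c / 3"] c(1) by (simp_all only: mult.assoc times_divide_eq_right) simp_all
  obtain z0 where z0: "1 < z0" "\<And>z. 0 < z \<Longrightarrow> z \<le> z0 \<Longrightarrow> free_walk_at r V rt p \<alpha> z" using convergence_radius by blast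
  define \<Phi> where "\<Phi> s = (\<Sum>i\<in>I. A i (X i (1 + s)) / (1 + \<kappa> * s + A i (X i (1 + s))))" for s
  have ev1: "\<forall>\<^sub>F t in at_right 0. \<Phi> (e * t) < \<Phi> 0"
  proof (rule eventually_decreasing_along)
    show "(\<Phi> has_real_derivative den - \<kappa> * num) (at 0)" unfolding \<Phi>_def[abs_def] by (rule eigenvalue_deriv)
    have "e * (den - \<kappa> * num) = e * (m - \<kappa>) * num" using num_pos by (simp add: m_def field_simps)
    also have "\<dots> < 0" by (rule mult_neg_pos[OF sgn(1) num_pos])
    finally show "e * (den - \<kappa> * num) < 0" .
  qed
  have ev2: "\<forall>\<^sub>F t in at_right 0. c * ln (1 + \<kappa>' * (e * t)) - ln (1 + e * t) < 0"
  proof -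
    have "((\<lambda>s. c * ln (1 + \<kappa>' * s) - ln (1 + s)) has_real_derivative c * \<kappa>' - 1) (at 0)"
      by (auto intro!: derivative_eq_intros)
    from eventually_decreasing_along[OF this sgn(2)] show ?thesis by simp
  qed
  have ev3: "\<forall>\<^sub>F t in at_right 0. \<forall>i\<in>I. X i (1 + e * t) < 1"
  proof (rule eventually_ball_finite)
    show "\<forall>i\<in>I. \<forall>\<^sub>F t in at_right 0. X i (1 + e * t) < 1"
    proof
      fix i assume i: "i \<in> I"
      have "isCont (\<lambda>s. X i (1 + s)) 0"
        by (rule isCont_o2[of 0 "\<lambda>s. 1 + s" "X i"]) (use DERIV_isCont[OF X_deriv(1)[OF i]] in auto)
      from eventually_less_along[OF this, of 1] show "\<forall>\<^sub>F t in at_right 0. X i (1 + e * t) < 1"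
        using X_1(2)[OF i] by simp
    qed
  qed simp
  have ev4: "\<forall>\<^sub>F t in at_right 0. 1 + e * t < z0" "\<forall>\<^sub>F t in at_right 0. - (1 + e * t) < 0"
    "\<forall>\<^sub>F t in at_right 0. - (1 + \<kappa> * (e * t)) < 0" "\<forall>\<^sub>F t in at_right 0. - (1 + \<kappa>' * (e * t)) < 0"
    using z0(1) by (intro eventually_less_along[of "\<lambda>s. 1 + s"] eventually_less_along[of "\<lambda>s. - (1 + s)"]
      eventually_less_along[of "\<lambda>s. - (1 + \<kappa> * s)"] eventually_less_along[of "\<lambda>s. - (1 + \<kappa>' * s)"]; simp)+
  have ev5: "\<forall>\<^sub>F t in at_right (0::real). 0 < t" by (simp add: eventually_at_right_less)
  have "\<forall>\<^sub>F t in at_right 0. 0 < t \<and> \<Phi> (e * t) < \<Phi> 0 \<and> c * ln (1 + \<kappa>' * (e * t)) - ln (1 + e * t) < 0 \<and>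
      (\<forall>i\<in>I. X i (1 + e * t) < 1) \<and> 1 + e * t < z0 \<and> - (1 + e * t) < 0 \<and>
      - (1 + \<kappa> * (e * t)) < 0 \<and> - (1 + \<kappa>' * (e * t)) < 0" (is "eventually ?Q _")
    using ev5 ev1 ev2 ev3 ev4 by (intro eventually_conj)
  from eventually_happens'[OF trivial_limit_at_right_real this] obtain t where "?Q t" ..
  then have t: "0 < t" "\<Phi> (e * t) < \<Phi> 0" "c * ln (1 + \<kappa>' * (e * t)) < ln (1 + e * t)"
    "\<And>i. i \<in> I \<Longrightarrow> X i (1 + e * t) < 1" "1 + e * t \<le> z0" "0 < 1 + e * t"
    "0 < 1 + \<kappa> * (e * t)" "0 < 1 + \<kappa>' * (e * t)"
    by (blast, blast, argo, blast, argo+)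
  \<comment> \<open>With \<open>s = e t\<close>: \<open>\<rho> = 1 + \<kappa> s\<close> is on the admissible side of the eigenvalue, and \<open>\<theta> \<rho> < 1\<close> as \<open>\<kappa> s < \<kappa>' s\<close>.\<close>
  define \<theta> where "\<theta> = 1 / (1 + \<kappa>' * (e * t))"
  have \<theta>: "0 < \<theta>" using t by (simp add: \<theta>_def)
  have "e * t * (\<kappa> - \<kappa>') < 0" using sgn(3) t(1) by (metis mult.commute mult.left_commute mult_pos_neg)
  then have \<theta>\<rho>: "\<theta> * (1 + \<kappa> * (e * t)) < 1" using t(8) by (simp add: \<theta>_def field_simps)
  have "\<theta> powr (- c) = exp (c * ln (1 + \<kappa>' * (e * t)))"
    using t(8) by (simp add: \<theta>_def powr_def ln_div)
  also have "\<dots> < exp (ln (1 + e * t))" using t(3) by simp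
  finally have small: "\<theta> powr (- c) < 1 + e * t" using t(6) by simp
  have "\<Phi> 0 = 1" using A_X_1 by (simp add: \<Phi>_def)
  then have "(\<Sum>i\<in>I. A i (X i (1 + e * t)) / (1 + \<kappa> * (e * t) + A i (X i (1 + e * t)))) \<le> 1"
    using t(2) by (simp add: \<Phi>_def)
  from chernoff[OF z0(2)[OF t(6,5)] t(4,7) this \<theta> \<theta>\<rho> small]
  have *: "AE \<omega> in M. \<forall>\<^sub>F n in sequentially. \<theta> powr real (length (Z n \<omega>)) < \<theta> powr (c * real n)"
    using \<theta> by (simp add: powr_realpow)
  have \<kappa>': "0 < \<kappa>'" using m c by (simp add: \<kappa>'_def add_pos_pos)
  show ?thesis
  proof (cases "num / den < c")
    case True
    then have "e = - 1" using c num_pos den_pos by (simp add: e_def m_def sgn_if field_simps)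
    then have "1 < \<theta>" using \<kappa>' t by (simp add: \<theta>_def field_simps)
    with * True show ?thesis by simp
  next
    case False
    then have "c < num / den" using c by simp
    then have "e = 1" using c num_pos den_pos by (simp add: e_def m_def sgn_if field_simps)
    then have "\<theta> < 1" using \<kappa>' t by (simp add: \<theta>_def field_simps)
    then have "ln \<theta> < 0" using \<theta> by simp
    then have "\<theta> powr x < \<theta> powr y \<longleftrightarrow> y < x" for x y :: real
      using \<theta> by (auto simp: powr_def mult_less_cancel_right_disj)
    with * False show ?thesis by simp
  qed
qed

theorem rate_of_escape: "AE \<omega> in M. (\<lambda>n. real (length (Z n \<omega>)) / real n) \<longlonglongrightarrow> num / den"
proof -
  define l where "l = num / den"
  have l: "0 < l" using num_pos den_pos by (simp add: l_def)
  have "AE \<omega> in M. \<forall>k. \<forall>\<^sub>F n in sequentially. real (length (Z n \<omega>)) < (l + l / real (k + 2)) * real n"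
    unfolding AE_all_countable
  proof
    fix k :: nat
    define c where "c = l + l / real (k + 2)"
    have c: "0 < c" "num / den < c" using l by (simp_all add: c_def l_def[symmetric] add_pos_pos)
    show "AE \<omega> in M. \<forall>\<^sub>F n in sequentially. real (length (Z n \<omega>)) < (l + l / real (k + 2)) * real n"
      using deviation[of c] c unfolding c_def[symmetric] by simp
  qed
  moreover have "AE \<omega> in M. \<forall>k. \<forall>\<^sub>F n in sequentially. (l - l / real (k + 2)) * real n < real (length (Z n \<omega>))"
    unfolding AE_all_countable
  proof
    fix k :: nat
    define c where "c = l - l / real (k + 2)"
    have c: "0 < c" "c < num / den" using l by (simp_all add: c_def l_def[symmetric] field_simps add_pos_nonneg)
    show "AE \<omega> in M. \<forall>\<^sub>F n in sequentially. (l - l / real (k + 2)) * real n < real (length (Z n \<omega>))"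
      using deviation[of c] c unfolding c_def[symmetric] by simp
  qed
  ultimately show ?thesis
  proof (eventually_elim)
    fix \<omega>
    assume up: "\<forall>k. \<forall>\<^sub>F n in sequentially. real (length (Z n \<omega>)) < (l + l / real (k + 2)) * real n"
      and lo: "\<forall>k. \<forall>\<^sub>F n in sequentially. (l - l / real (k + 2)) * real n < real (length (Z n \<omega>))"
    show "(\<lambda>n. real (length (Z n \<omega>)) / real n) \<longlonglongrightarrow> num / den"
      unfolding l_def[symmetric]
    proof (rule tendstoI)
      fix \<epsilon> :: real assume \<epsilon>: "0 < \<epsilon>"
      obtain k where k: "l / \<epsilon> < real k" using reals_Archimedean2 by blast
      then have k': "l / real (k + 2) < \<epsilon>" using \<epsilon> l by (simp add: field_simps)
      show "\<forall>\<^sub>F n in sequentially. dist (real (length (Z n \<omega>)) / real n) l < \<epsilon>"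
        using up[rule_format, of k] lo[rule_format, of k] eventually_gt_at_top[of 0]
      proof eventually_elim
        fix n :: nat
        assume n: "real (length (Z n \<omega>)) < (l + l / real (k + 2)) * real n"
          "(l - l / real (k + 2)) * real n < real (length (Z n \<omega>))" "0 < n"
        then have "real (length (Z n \<omega>)) / real n < l + l / real (k + 2)"
          "l - l / real (k + 2) < real (length (Z n \<omega>)) / real n"
          by (simp_all only: pos_divide_less_eq pos_less_divide_eq of_nat_0_less_iff)
        then show "dist (real (length (Z n \<omega>)) / real n) l < \<epsilon>"
          using k' by (simp add: dist_real_def abs_if)
      qed
    qed
  qed
qed

end

theorem mainTheorem3:
  fixes r :: nat
    and V :: "nat \<Rightarrow> 'a set" and rt :: "nat \<Rightarrow> 'a"
    and p :: "nat \<Rightarrow> 'a \<Rightarrow> 'a \<Rightarrow> real" and \<alpha> :: "nat \<Rightarrow> real"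
    and M :: "'w measure" and Z :: "nat \<Rightarrow> 'w \<Rightarrow> 'a list"
  assumes "2 \<le> r"
    and "\<And>i. i \<in> {1..r} \<Longrightarrow> countable (V i)"
    and "disjoint_family_on V {1..r}"
    and "\<And>i. i \<in> {1..r} \<Longrightarrow> rt i \<in> V i"
    and "\<And>i. i \<in> {1..r} \<Longrightarrow> transition_matrix (V i) (p i)"
    and "\<And>i x. i \<in> {1..r} \<Longrightarrow> x \<in> V i \<Longrightarrow> p i x x = 0"
    and "\<And>i x. i \<in> {1..r} \<Longrightarrow> x \<in> V i \<Longrightarrow> \<exists>n\<ge>1. nstep (V i) (p i) n (rt i) x > 0"
    and "\<And>i. i \<in> {1..r} \<Longrightarrow> \<alpha> i > 0"
    and "(\<Sum>i\<in>{1..r}. \<alpha> i) = 1"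
    and "conv_radius (\<lambda>n. nstep (free_product r V rt) (walk_matrix r V rt p \<alpha>) n [] []) > 1"
    and "markov_chain_from M (free_product r V rt) (walk_matrix r V rt p \<alpha>) [] Z"
  shows "AE \<omega> in M. (\<lambda>n. real (length (Z n \<omega>)) / real n) \<longlonglongrightarrow>
    (let \<xi> = (\<lambda>i. xi M Z V rt \<alpha> i);
         G = (\<lambda>i. green (V i) (p i) (rt i) (rt i))
     in (\<Sum>i\<in>{1..r}. (1 - (1 - \<xi> i 1) * G i (\<xi> i 1)) * G i (\<xi> i 1) * (1 - \<xi> i 1)) /
        (\<Sum>i\<in>{1..r}. deriv (\<xi> i) 1 * (G i (\<xi> i 1) - (1 - \<xi> i 1) * deriv (G i) (\<xi> i 1))))"
proof -
  interpret free_walk_chain r V rt p \<alpha> M Z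
    by unfold_locales (fact assms)+
  show ?thesis
    using rate_of_escape unfolding num_def den_def Gr_def[abs_def] Let_def .
qed

end
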